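(* Let $r\ge1$, let $\boldsymbol{a}=(a_1,\dots,a_r)\in\mathbb{R}^r$ satisfy $a_1\ge a_2\ge\cdots\ge a_r\ge a_1-r$, and let $\boldsymbol{w}=(w_1,\dots,w_r)$ be the solution of the Toda lattice with opposite sign corresponding to $\boldsymbol{a}$ (see context). Suppose that there exist integers $k_0$ and $\ell$ with $0\le k_0\le r-1$ such that, for all $i,j\in\{1,\dots,r\}$, $$a_i+a_j=\begin{cases}-\ell & (i+j=r+1-k_0)\\ -\ell-r & (i+j=2r+1-k_0).\end{cases}$$ Then for $i,j\in\{1,\dots,r\}$ with $i+j+k_0-1\equiv 0$ modulo $r_0$ we have $$w_i+w_j=(\ell-r+1+k_0)\log|q|.$$
   Context: The Toda lattice with opposite sign here is the system $2\partial_{\bar q}\partial_q w_i-r^2e^{2(w_i-w_{i-1})}+r^2e^{2(w_{i+1}-w_i)}=0$ ($i=1,\dots,r$, $w_{r+i}=w_i$) for $\mathbb{R}$-valued $C^\infty$-functions on $\mathbb{C}^*$ with coordinate $q$. Put $a=\sum_i a_i$. The solution corresponding to $\boldsymbol a$ is the unique solution $\boldsymbol{w}$ such that $\sum_i w_i=\bigl(-\frac{r(r-1)}{2}-a\bigr)\log|q|$ and, for each $i$, $a_i=\min\{c\in\mathbb{R}\mid |q|^{i-1}e^{w_i}=O(|q|^{-c-\epsilon})\text{ as }q\to0\text{ for every }\epsilon>0\}$. The integer $r_0$ is defined as follows: put $b_i:=ra_i+ri$ for $1\le i\le r$, extend to all $i\in\mathbb{Z}$ by $b_{i+r}=b_i$,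 and let $r_0$ be the minimum of $\{1\le j\le r\mid b_{i+j}=b_i\ \text{for all } i\}$ (this set contains $r$). *)

theory Defs
  imports
    "HOL-Analysis.Analysis"
    "HOL-Library.Landau_Symbols"
    "HOL-Number_Theory.Cong"
begin

text \<open>The class \<open>C\<^sup>k\<close> on an open set, by induction on \<open>k\<close> through directional derivatives.\<close>

primrec Ck_on :: "nat \<Rightarrow> ('a::real_normed_vector \<Rightarrow> 'b::real_normed_vector) \<Rightarrow> 'a set \<Rightarrow> bool" where
  "Ck_on 0 f S \<longleftrightarrow> continuous_on S f"
| "Ck_on (Suc k) f S \<longleftrightarrow>
     (\<forall>x\<in>S. f differentiable (at x)) \<and> (\<forall>v. Ck_on k (\<lambda>x. frechet_derivative f (at x) v) S)"

definition smooth_on :: "('a::real_normed_vector \<Rightarrow> 'b::real_normed_vector) \<Rightarrow> 'a set \<Rightarrow> bool" where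
  "smooth_on f S \<longleftrightarrow> (\<forall>k. Ck_on k f S)"

text \<open>Wirtinger derivatives; for \<open>q = x + \<i> y\<close> the derivatives in the directions
  \<open>1\<close> and \<open>\<i>\<close> are the partial derivatives with respect to \<open>x\<close> and \<open>y\<close>.\<close>

definition d_q :: "(complex \<Rightarrow> complex) \<Rightarrow> complex \<Rightarrow> complex" where
  "d_q f q = (frechet_derivative f (at q) 1 - \<i> * frechet_derivative f (at q) \<i>) / 2"

definition d_qbar :: "(complex \<Rightarrow> complex) \<Rightarrow> complex \<Rightarrow> complex" where
  "d_qbar f q = (frechet_derivative f (at q) 1 + \<i> * frechet_derivative f (at q) \<i>) / 2"

text \<open>A tuple \<open>(x\<^sub>1, \<dots>, x\<^sub>r)\<close> is a function on \<open>nat\<close> of which only the values at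
  \<open>1, \<dots>, r\<close> are used. The following is its extension to \<open>\<int>\<close> with
  \<open>x\<^bsub>i+r\<^esub> = x\<^sub>i\<close>.\<close>

definition cyc_ext :: "nat \<Rightarrow> (nat \<Rightarrow> 'a) \<Rightarrow> int \<Rightarrow> 'a" where
  "cyc_ext r x i = x (nat ((i - 1) mod int r) + 1)"

definition toda_opposite_solution :: "nat \<Rightarrow> (nat \<Rightarrow> complex \<Rightarrow> real) \<Rightarrow> bool" where
  "toda_opposite_solution r w \<longleftrightarrow>
     (\<forall>i\<in>{1..r}. smooth_on (w i) (- {0})) \<and>
     (\<forall>i\<in>{1..r}. \<forall>q. q \<noteq> 0 \<longrightarrow>
        (let W = cyc_ext r w; n = int i in
          2 * d_qbar (d_q (\<lambda>p. complex_of_real (W n p))) q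
          - complex_of_real ((real r)\<^sup>2 * exp (2 * (W n q - W (n - 1) q)))
          + complex_of_real ((real r)\<^sup>2 * exp (2 * (W (n + 1) q - W n q))) = 0))"

definition is_min_of :: "real \<Rightarrow> real set \<Rightarrow> bool" where
  "is_min_of m S \<longleftrightarrow> m \<in> S \<and> (\<forall>c\<in>S. m \<le> c)"

text \<open>The conditions below determine \<open>w\<close> uniquely on \<open>\<complex> - {0}\<close>; this uniqueness is a
  theorem and not part of the definition. The values at \<open>q = 0\<close> are irrelevant.\<close>

definition toda_solution_corresponding ::
    "nat \<Rightarrow> (nat \<Rightarrow> real) \<Rightarrow> (nat \<Rightarrow> complex \<Rightarrow> real) \<Rightarrow> bool" where
  "toda_solution_corresponding r a w \<longleftrightarrow>
     toda_opposite_solution r w \<and>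
     (\<forall>q. q \<noteq> 0 \<longrightarrow>
        (\<Sum>i=1..r. w i q) = (- (real r * (real r - 1) / 2) - (\<Sum>i=1..r. a i)) * ln (cmod q)) \<and>
     (\<forall>i\<in>{1..r}. is_min_of (a i)
        {c. \<forall>\<epsilon>>0. (\<lambda>q. cmod q ^ (i - 1) * exp (w i q)) \<in> O[at 0](\<lambda>q. cmod q powr (- c - \<epsilon>))})"

definition toda_b :: "nat \<Rightarrow> (nat \<Rightarrow> real) \<Rightarrow> int \<Rightarrow> real" where
  "toda_b r a = cyc_ext r (\<lambda>i. real r * a i + real r * real i)"

definition toda_r0 :: "nat \<Rightarrow> (nat \<Rightarrow> real) \<Rightarrow> nat" where
  "toda_r0 r a = Min {j \<in> {1..r}. \<forall>i. toda_b r a (i + int j) = toda_b r a i}"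

end

(*
  Under the maximum principle the opposite-sign Toda lattice behaves like a scalar equation with
  monotone nonlinearity. With X_n = exp (2 (w_n - w_(n-1))), whose cyclic product is 1, the sum of
  the X_n satisfies a Keller-Osserman inequality, so the differences w_n - w_(n-1) are bounded
  away from 0. Hence the difference u of two solutions with equal sums is bounded near infinity,
  and if both correspond to the same exponents it is o(log |q|) near 0. Its Euclidean norm is
  subharmonic, strictly where u is nonzero, so u = 0. The identity follows by applying this
  uniqueness to the solution shifted by r_0 and to the reflected solution
  c log |q| - w_(1 - k_0 - n), which both have the exponents of w.
*)

theory Submission
  imports Defs
begin

section \<open>Laplacians and the maximum principle\<close>

text \<open>The exponents constrain a solution only at the origin, so control at infinity has to
  come from the equation itself. Averaging the Laplacians of ln X_n with weights X_n gives a
  Dirichlet energy over the cycle. Since some X_n is at most 1, this energy is at least a constant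
  times the square of the sum f once f is large, so the Laplacian of ln f is bounded below by a
  multiple of f, in the barrier sense. As in the Ahlfors-Schwarz lemma, this bounds f at the centre
  of every unit disc avoiding 0 by one constant. Neither ln f nor the norm of u is differentiated.
  At a maximum each is replaced, up to scaling and a constant, by a combination of the w_n with
  coefficients frozen at that point that touches it from below, so linear rules for the Laplacian
  suffice. At the origin the growth conditions give upper bounds, which the prescribed sum makes
  two-sided: w_n + (a_n + n - 1) log |q| = o(log |q|). Since b_n = r (a_n + n), the exponents have
  period r_0. The hypothesis on a_i + a_j says that they are antisymmetric, up to a constant, under
  n -> 1 - k_0 - n.\<close>

definition has_second_dir_deriv :: "(complex \<Rightarrow> real) \<Rightarrow> complex \<Rightarrow> complex \<Rightarrow> real \<Rightarrow> bool" where
  "has_second_dir_deriv g v q s \<longleftrightarrow>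
     (\<exists>g'. (\<forall>\<^sub>F t in nhds 0. ((\<lambda>t. g (q + of_real t * v)) has_real_derivative g' t) (at t)) \<and>
           (g' has_real_derivative s) (at 0))"

text \<open>A relation built from restrictions to the two coordinate lines: this is all that the
  test at a local maximum needs, and sums and multiples carry no differentiability side
  conditions.\<close>

definition has_laplacian :: "(complex \<Rightarrow> real) \<Rightarrow> complex \<Rightarrow> real \<Rightarrow> bool" where
  "has_laplacian g q L \<longleftrightarrow>
     (\<exists>A B. has_second_dir_deriv g 1 q A \<and> has_second_dir_deriv g \<i> q B \<and> L = A + B)"

section \<open>Linearity of the Laplacian\<close>

lemma has_second_dir_deriv_const: "has_second_dir_deriv (\<lambda>_. c) v q 0"
  unfolding has_second_dir_deriv_def by (intro exI[of _ "\<lambda>_. 0"]) auto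

lemma has_second_dir_deriv_add:
  assumes "has_second_dir_deriv f v q s" "has_second_dir_deriv g v q t"
  shows "has_second_dir_deriv (\<lambda>x. f x + g x) v q (s + t)"
proof -
  obtain f' where f: "\<forall>\<^sub>F t in nhds 0. ((\<lambda>t. f (q + of_real t * v)) has_real_derivative f' t) (at t)"
      "(f' has_real_derivative s) (at 0)"
    using assms(1) unfolding has_second_dir_deriv_def by blast
  obtain g' where g: "\<forall>\<^sub>F t in nhds 0. ((\<lambda>t. g (q + of_real t * v)) has_real_derivative g' t) (at t)"
      "(g' has_real_derivative t) (at 0)"
    using assms(2) unfolding has_second_dir_deriv_def by blast
  show ?thesis
    unfolding has_second_dir_deriv_def
  proof (intro exI[of _ "\<lambda>t. f' t + g' t"] conjI)
    show "\<forall>\<^sub>F t in nhds 0. ((\<lambda>t. f (q + of_real t * v) + g (q + of_real t * v))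
            has_real_derivative f' t + g' t) (at t)"
      using f(1) g(1) by eventually_elim (rule DERIV_add)
  qed (intro DERIV_add f g)
qed

lemma has_second_dir_deriv_cmult:
  assumes "has_second_dir_deriv f v q s"
  shows "has_second_dir_deriv (\<lambda>x. c * f x) v q (c * s)"
proof -
  obtain f' where f: "\<forall>\<^sub>F t in nhds 0. ((\<lambda>t. f (q + of_real t * v)) has_real_derivative f' t) (at t)"
      "(f' has_real_derivative s) (at 0)"
    using assms(1) unfolding has_second_dir_deriv_def by blast
  show ?thesis
    unfolding has_second_dir_deriv_def
  proof (intro exI[of _ "\<lambda>t. c * f' t"] conjI)
    show "\<forall>\<^sub>F t in nhds 0. ((\<lambda>t. c * f (q + of_real t * v)) has_real_derivative c * f' t) (at t)"
      using f(1) by eventually_elim (rule DERIV_cmult)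
  qed (intro DERIV_cmult f)
qed

lemma has_laplacian_const: "has_laplacian (\<lambda>_. c) q 0"
  unfolding has_laplacian_def using has_second_dir_deriv_const by (intro exI[of _ 0]) auto

lemma has_laplacian_add:
  assumes "has_laplacian f q K" "has_laplacian g q L"
  shows "has_laplacian (\<lambda>x. f x + g x) q (K + L)"
proof -
  from assms obtain A B C D where *:
    "has_second_dir_deriv f 1 q A" "has_second_dir_deriv f \<i> q B" "K = A + B"
    "has_second_dir_deriv g 1 q C" "has_second_dir_deriv g \<i> q D" "L = C + D"
    unfolding has_laplacian_def by blast
  show ?thesis unfolding has_laplacian_def
    by (rule exI[of _ "A + C"], rule exI[of _ "B + D"])
      (use * in \<open>auto intro: has_second_dir_deriv_add\<close>)
qed

lemma has_laplacian_cmult: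
  assumes "has_laplacian f q K"
  shows "has_laplacian (\<lambda>x. c * f x) q (c * K)"
proof -
  from assms obtain A B where *:
    "has_second_dir_deriv f 1 q A" "has_second_dir_deriv f \<i> q B" "K = A + B"
    unfolding has_laplacian_def by blast
  show ?thesis unfolding has_laplacian_def
    by (rule exI[of _ "c * A"], rule exI[of _ "c * B"])
      (use * in \<open>auto intro: has_second_dir_deriv_cmult simp: distrib_left\<close>)
qed

lemma has_laplacian_diff:
  assumes "has_laplacian f q K" "has_laplacian g q L"
  shows "has_laplacian (\<lambda>x. f x - g x) q (K - L)"
  using has_laplacian_add[OF assms(1) has_laplacian_cmult[OF assms(2), of "-1"]] by simp

lemma has_laplacian_sum:
  assumes "finite S" "\<And>n. n \<in> S \<Longrightarrow> has_laplacian (f n) q (L n)"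
  shows "has_laplacian (\<lambda>x. \<Sum>n\<in>S. f n x) q (\<Sum>n\<in>S. L n)"
  using assms
  by (induction S rule: finite_induct) (auto intro: has_laplacian_const has_laplacian_add)

section \<open>Second derivative test at a local maximum\<close>

lemma second_deriv_nonpos_at_local_max:
  fixes f :: "real \<Rightarrow> real"
  assumes f: "\<forall>\<^sub>F t in nhds 0. (f has_real_derivative f' t) (at t)"
    and s: "(f' has_real_derivative s) (at 0)"
    and max: "\<forall>\<^sub>F t in nhds 0. f t \<le> f 0"
  shows "s \<le> 0"
proof (rule ccontr)
  assume "\<not> s \<le> 0"
  obtain d where d: "d > 0" "\<And>t. \<bar>t\<bar> < d \<Longrightarrow> (f has_real_derivative f' t) (at t) \<and> f t \<le> f 0"
    using eventually_conj[OF f max] unfolding eventually_nhds_metric dist_real_def by auto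
  have "f' 0 = 0"
    using d by (intro DERIV_local_max[of f "f' 0" 0 d]) auto
  \<comment> \<open>If \<open>s\<close> were positive, \<open>f'\<close> would be positive just to
    the right of its zero at 0, so \<open>f\<close> would increase strictly there.\<close>
  obtain e where e: "e > 0" "\<And>h. 0 < h \<Longrightarrow> h < e \<Longrightarrow> f' 0 < f' (0 + h)"
    using DERIV_pos_inc_right[OF s] \<open>\<not> s \<le> 0\<close> by auto
  define t where "t = min d e / 2"
  have t: "0 < t" "t < d" "t < e" using d(1) e(1) by (auto simp: t_def)
  have "f 0 < f t"
  proof (rule DERIV_pos_imp_increasing_open[OF t(1)])
    show "\<exists>y. (f has_real_derivative y) (at x) \<and> 0 < y" if "0 < x" "x < t" for x
      using that t d(2)[of x] e(2)[of x] \<open>f' 0 = 0\<close> by auto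
    show "continuous_on {0..t} f"
    proof (intro continuous_at_imp_continuous_on ballI)
      show "isCont f x" if "x \<in> {0..t}" for x
        using that t d(2)[of x] by (auto dest: DERIV_isCont)
    qed
  qed
  then show False using d(2)[of t] t by auto
qed

lemma has_second_dir_deriv_nonpos_at_local_max:
  assumes "has_second_dir_deriv g v q s" "\<forall>\<^sub>F x in nhds q. g x \<le> g q"
  shows "s \<le> 0"
proof -
  obtain g' where g: "\<forall>\<^sub>F t in nhds 0. ((\<lambda>t. g (q + of_real t * v)) has_real_derivative g' t) (at t)"
      "(g' has_real_derivative s) (at 0)"
    using assms(1) unfolding has_second_dir_deriv_def by blast
  have "isCont (\<lambda>t::real. q + of_real t * v) 0" by (intro continuous_intros)
  then have "filterlim (\<lambda>t::real. q + of_real t * v) (nhds q) (nhds 0)"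
    using tendsto_at_iff_tendsto_nhds[of "\<lambda>t::real. q + of_real t * v" 0] by (simp add: isCont_def)
  then have "\<forall>\<^sub>F t::real in nhds 0. g (q + of_real t * v) \<le> g q"
    using assms(2) by (rule eventually_compose_filterlim[rotated])
  with g show ?thesis
    by (intro second_deriv_nonpos_at_local_max[of "\<lambda>t. g (q + of_real t * v)" g' s]) auto
qed

lemma has_laplacian_nonpos_at_local_max:
  assumes "has_laplacian g q L" "\<forall>\<^sub>F x in nhds q. g x \<le> g q"
  shows "L \<le> 0"
proof -
  obtain A B where *: "has_second_dir_deriv g 1 q A" "has_second_dir_deriv g \<i> q B" "L = A + B"
    using assms(1) unfolding has_laplacian_def by blast
  show ?thesis
    using has_second_dir_deriv_nonpos_at_local_max[OF *(1) assms(2)]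
      has_second_dir_deriv_nonpos_at_local_max[OF *(2) assms(2)] *(3) by simp
qed

text \<open>On a line both |x|^2 and 1 - |x - p|^2 are quadratic polynomials in the parameter, so a
  single computation of (ln Q)'' = Q''/Q - (Q'/Q)^2 at 0 serves the harmonic function ln |q| and the
  weight on a disc.\<close>

lemma has_second_dir_deriv_ln_quadratic:
  assumes g: "\<And>t. g (q + of_real t * v) = ln (c0 + c1 * t + c2 * t\<^sup>2)" and "c0 > 0"
  shows "has_second_dir_deriv g v q (2 * c2 / c0 - (c1 / c0)\<^sup>2)"
  unfolding has_second_dir_deriv_def g
proof (intro exI[of _ "\<lambda>t. (c1 + 2 * c2 * t) / (c0 + c1 * t + c2 * t\<^sup>2)"] conjI)
  have "isCont (\<lambda>t. c0 + c1 * t + c2 * t\<^sup>2) 0" by (intro continuous_intros)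
  then have "((\<lambda>t. c0 + c1 * t + c2 * t\<^sup>2) \<longlongrightarrow> c0) (nhds 0)"
    using tendsto_at_iff_tendsto_nhds[of "\<lambda>t. c0 + c1 * t + c2 * t\<^sup>2" 0] by (simp add: isCont_def)
  then have "\<forall>\<^sub>F t in nhds 0. c0 + c1 * t + c2 * t\<^sup>2 > 0"
    using \<open>c0 > 0\<close> by (rule order_tendstoD(1))
  then show "\<forall>\<^sub>F t in nhds 0. ((\<lambda>t. ln (c0 + c1 * t + c2 * t\<^sup>2))
      has_real_derivative (c1 + 2 * c2 * t) / (c0 + c1 * t + c2 * t\<^sup>2)) (at t)"
    by eventually_elim (auto intro!: derivative_eq_intros simp: field_simps)
  show "((\<lambda>t. (c1 + 2 * c2 * t) / (c0 + c1 * t + c2 * t\<^sup>2))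
      has_real_derivative 2 * c2 / c0 - (c1 / c0)\<^sup>2) (at 0)"
    using \<open>c0 > 0\<close> by (auto intro!: derivative_eq_intros simp: field_simps power2_eq_square)
qed

lemma has_laplacian_ln_cmod:
  assumes "q \<noteq> 0"
  shows "has_laplacian (\<lambda>x. ln (cmod x)) q 0"
proof -
  define A where "A = (cmod q)\<^sup>2"
  have A: "A > 0" "A = (Re q)\<^sup>2 + (Im q)\<^sup>2"
    using assms by (simp_all add: A_def) (simp add: cmod_power2)
  have "has_second_dir_deriv (\<lambda>x. ln ((cmod x)\<^sup>2)) 1 q (2 * 1 / A - (2 * Re q / A)\<^sup>2)"
    by (rule has_second_dir_deriv_ln_quadratic)
      (simp only: cmod_power2 A(2), simp add: power2_eq_square algebra_simps, rule A(1))
  moreover have "has_second_dir_deriv (\<lambda>x. ln ((cmod x)\<^sup>2)) \<i> q (2 * 1 / A - (2 * Im q / A)\<^sup>2)"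
    by (rule has_second_dir_deriv_ln_quadratic)
      (simp only: cmod_power2 A(2), simp add: power2_eq_square algebra_simps, rule A(1))
  moreover have "(2 * 1 / A - (2 * Re q / A)\<^sup>2) + (2 * 1 / A - (2 * Im q / A)\<^sup>2) = 0"
  proof -
    have "(2 * 1 / A - (2 * Re q / A)\<^sup>2) + (2 * 1 / A - (2 * Im q / A)\<^sup>2)
        = 4 / A - 4 * ((Re q)\<^sup>2 + (Im q)\<^sup>2) / A\<^sup>2"
      by (simp add: power_divide power_mult_distrib add_divide_distrib algebra_simps)
    also have "\<dots> = 4 / A - 4 * A / A\<^sup>2" using A(2) by simp
    also have "\<dots> = 0" using A(1) by (simp add: power2_eq_square)
    finally show ?thesis .
  qed
  ultimately have "has_laplacian (\<lambda>x. ln ((cmod x)\<^sup>2)) q 0"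
    unfolding has_laplacian_def by metis
  then have "has_laplacian (\<lambda>x. (1 / 2) * ln ((cmod x)\<^sup>2)) q ((1 / 2) * 0)"
    by (rule has_laplacian_cmult)
  \<comment> \<open>The identity of functions also needs x = 0, where both sides are 0 because
    \<open>ln 0 = 0\<close>.\<close>
  moreover have "(1 / 2) * ln ((cmod x)\<^sup>2) = ln (cmod x)" for x
    by (cases "x = 0") (simp_all add: ln_realpow)
  ultimately show ?thesis by simp
qed

text \<open>The curvature equation of the Poincare metric: -2 ln (1 - |x - p|^2) has Laplacian 8 /
  (1 - |x - p|^2)^2.\<close>

lemma has_laplacian_ln_one_minus_dist:
  assumes "cmod (q - p) < 1"
  shows "has_laplacian (\<lambda>x. ln (1 - (cmod (x - p))\<^sup>2)) q (- 4 / (1 - (cmod (q - p))\<^sup>2)\<^sup>2)"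
proof -
  define A where "A = 1 - (cmod (q - p))\<^sup>2"
  have A: "A > 0" "A = 1 - ((Re (q - p))\<^sup>2 + (Im (q - p))\<^sup>2)"
    unfolding A_def using assms by (simp add: abs_square_less_1) (simp add: cmod_power2)
  have "has_second_dir_deriv (\<lambda>x. ln (1 - (cmod (x - p))\<^sup>2)) 1 q
      (2 * (-1) / A - (-2 * Re (q - p) / A)\<^sup>2)"
    by (rule has_second_dir_deriv_ln_quadratic)
      (simp only: cmod_power2 A(2), simp add: power2_eq_square algebra_simps, rule A(1))
  moreover have "has_second_dir_deriv (\<lambda>x. ln (1 - (cmod (x - p))\<^sup>2)) \<i> q
      (2 * (-1) / A - (-2 * Im (q - p) / A)\<^sup>2)"
    by (rule has_second_dir_deriv_ln_quadratic)
      (simp only: cmod_power2 A(2), simp add: power2_eq_square algebra_simps, rule A(1))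
  moreover have "(2 * (-1) / A - (-2 * Re (q - p) / A)\<^sup>2) + (2 * (-1) / A - (-2 * Im (q - p) / A)\<^sup>2)
      = - 4 / A\<^sup>2"
  proof -
    have "(2 * (-1) / A - (-2 * Re (q - p) / A)\<^sup>2) + (2 * (-1) / A - (-2 * Im (q - p) / A)\<^sup>2)
        = - 4 / A - 4 * ((Re (q - p))\<^sup>2 + (Im (q - p))\<^sup>2) / A\<^sup>2"
      by (simp add: power_divide power_mult_distrib add_divide_distrib distrib_left
        del: minus_complex.sel)
    also have "\<dots> = - 4 / A - 4 * (1 - A) / A\<^sup>2" using A(2) by simp
    also have "\<dots> = - 4 / A\<^sup>2" using A(1) by (simp add: field_simps power2_eq_square)
    finally show ?thesis .
  qed
  ultimately show ?thesis unfolding has_laplacian_def A_def[symmetric] by metis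
qed

section \<open>Periodic families\<close>

lemma periodic_sum_shift1:
  fixes F :: "int \<Rightarrow> 'a::comm_monoid_add"
  assumes "\<And>n. F (n + int r) = F n"
  shows "(\<Sum>n\<in>{1..int r}. F (n - 1)) = (\<Sum>n\<in>{1..int r}. F n)"
proof (cases "r = 0")
  case False
  have "(\<Sum>n\<in>{1..int r}. F (n - 1)) = (\<Sum>n\<in>{0..int r - 1}. F n)"
    by (rule sum.reindex_bij_witness[of _ "\<lambda>n. n + 1" "\<lambda>n. n - 1"]) auto
  also have "{0..int r - 1} = insert 0 {1..int r - 1}" using False by auto
  also have "sum F \<dots> = F (int r) + sum F {1..int r - 1}" using assms[of 0] by simp
  also have "\<dots> = sum F (insert (int r) {1..int r - 1})" by simp
  also have "insert (int r) {1..int r - 1} = {1..int r}" using False by auto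
  finally show ?thesis .
qed simp

lemma periodic_sum_shift:
  fixes F :: "int \<Rightarrow> 'a::comm_monoid_add"
  assumes "\<And>n. F (n + int r) = F n"
  shows "(\<Sum>n\<in>{1..int r}. F (n + k)) = (\<Sum>n\<in>{1..int r}. F n)"
proof -
  have step: "(\<Sum>n\<in>{1..int r}. F (n + (i + 1))) = (\<Sum>n\<in>{1..int r}. F (n + i))" for i
    using periodic_sum_shift1[of "\<lambda>n. F (n + (i + 1))" r] assms[of "_ + (i + 1)"]
    by (simp add: algebra_simps)
  show ?thesis
  proof (induction k rule: int_induct[of _ 0])
    case (step1 i)
    then show ?case using step[of i] by simp
  next
    case (step2 i)
    then show ?case using step[of "i - 1"] by simp
  qed simp
qed

lemma periodic_sum_reflect:
  fixes F :: "int \<Rightarrow> 'a::comm_monoid_add"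
  assumes "\<And>n. F (n + int r) = F n"
  shows "(\<Sum>n\<in>{1..int r}. F (m - n)) = (\<Sum>n\<in>{1..int r}. F n)"
proof -
  have "(\<Sum>n\<in>{1..int r}. F (m - n)) = (\<Sum>n\<in>{1..int r}. F (n + (m - int r - 1)))"
    by (rule sum.reindex_bij_witness[of _ "\<lambda>n. int r + 1 - n" "\<lambda>n. int r + 1 - n"]) auto
  then show ?thesis using periodic_sum_shift[of F r, OF assms] by simp
qed

text \<open>Telescoping along the arc from one index to the other inside one period. It turns bounds
  on increments into bounds on the oscillation.\<close>

lemma diff_le_sum_abs_steps:
  fixes F :: "int \<Rightarrow> real"
  assumes "i \<in> {1..int r}" "j \<in> {1..int r}"
  shows "\<bar>F i - F j\<bar> \<le> (\<Sum>n\<in>{1..int r}. \<bar>F n - F (n - 1)\<bar>)"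
proof -
  have aux: "\<bar>F i - F j\<bar> \<le> (\<Sum>n\<in>{j<..i}. \<bar>F n - F (n - 1)\<bar>)" if "j \<le> i" for i j
    using that
  proof (induction i rule: int_ge_induct)
    case (step i)
    have "{j<..i + 1} = insert (i + 1) {j<..i}" using step.hyps by auto
    then show ?case using step.IH by simp
  qed simp
  have sub: "(\<Sum>n\<in>{j<..i}. \<bar>F n - F (n - 1)\<bar>) \<le> (\<Sum>n\<in>{1..int r}. \<bar>F n - F (n - 1)\<bar>)"
    if "1 \<le> j" "i \<le> int r" for i j
    using that by (intro sum_mono2) auto
  show ?thesis
  proof (cases "j \<le> i")
    case True
    then show ?thesis using aux[of j i] sub[of j i] assms by auto
  next
    case False
    then show ?thesis using aux[of i j] sub[of i j] assms by (auto simp: abs_minus_commute)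
  qed
qed

lemma periodic_mult:
  fixes F :: "int \<Rightarrow> 'a"
  assumes "\<And>n. F (n + k) = F n"
  shows "F (n + k * t) = F n"
proof (induction t rule: int_induct[of _ 0])
  case (step1 i)
  then show ?case using assms[of "n + k * i"] by (simp add: algebra_simps)
next
  case (step2 i)
  then show ?case using assms[of "n + k * (i - 1)"] by (simp add: algebra_simps)
qed simp

lemma periodic_exists_index:
  assumes "\<And>n. F (n + int r) = F n" "r \<ge> 1"
  shows "\<exists>m\<in>{1..int r}. F n = F m"
proof -
  from periodic_mult[of F "int r", OF assms(1), of "(n - 1) mod int r + 1" "(n - 1) div int r"]
  have "F n = F ((n - 1) mod int r + 1)" by (simp add: algebra_simps)
  moreover have "(n - 1) mod int r + 1 \<in> {1..int r}"
    using assms(2) pos_mod_bound[of "int r" "n - 1"] pos_mod_sign[of "int r" "n - 1"]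
    unfolding atLeastAtMost_iff by linarith
  ultimately show ?thesis by blast
qed

text \<open>Indexing by the integers makes the shift and the reflection plain re-indexings, and the
  stated regularity is what the maximum principle consumes. The factor 2 r^2 arises because the
  Laplacian is four times the mixed Wirtinger derivative.\<close>

definition periodic_toda :: "nat \<Rightarrow> (int \<Rightarrow> complex \<Rightarrow> real) \<Rightarrow> bool" where
  "periodic_toda r W \<longleftrightarrow>
     (\<forall>n. W (n + int r) = W n) \<and> (\<forall>n. continuous_on (- {0}) (W n)) \<and>
     (\<forall>n q. q \<noteq> 0 \<longrightarrow> has_laplacian (W n) q
        (2 * (real r)\<^sup>2 * (exp (2 * (W n q - W (n - 1) q)) - exp (2 * (W (n + 1) q - W n q)))))"

lemma periodic_todaD:
  assumes "periodic_toda r W"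
  shows "W (n + int r) = W n" "continuous_on (- {0}) (W n)"
    "q \<noteq> 0 \<Longrightarrow> has_laplacian (W n) q
        (2 * (real r)\<^sup>2 * (exp (2 * (W n q - W (n - 1) q)) - exp (2 * (W (n + 1) q - W n q))))"
  using assms unfolding periodic_toda_def by blast+

lemma periodic_toda_shift:
  assumes "periodic_toda r W"
  shows "periodic_toda r (\<lambda>n. W (n + k))"
  unfolding periodic_toda_def
proof (intro conjI allI impI)
  show "W (n + int r + k) = W (n + k)" for n
    using periodic_todaD(1)[OF assms, of "n + k"] by (simp add: ac_simps)
  show "continuous_on (- {0}) (W (n + k))" for n
    by (rule periodic_todaD(2)[OF assms])
  show "has_laplacian (W (n + k)) q (2 * (real r)\<^sup>2 *
      (exp (2 * (W (n + k) q - W (n - 1 + k) q)) - exp (2 * (W (n + 1 + k) q - W (n + k) q))))"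
    if "q \<noteq> 0" for n q
    using periodic_todaD(3)[OF assms that, of "n + k"] by (simp add: algebra_simps)
qed

text \<open>Reversing the index and negating each flip the sign of an increment, so the increment of
  the new family at n is that of \<open>W\<close> at m - n + 1. The term
  \<open>c * ln (cmod q)\<close> is harmonic and cancels in the increments.\<close>

lemma periodic_toda_reflect:
  assumes "periodic_toda r W"
  shows "periodic_toda r (\<lambda>n q. c * ln (cmod q) - W (m - n) q)"
  unfolding periodic_toda_def
proof (intro conjI allI impI)
  show "(\<lambda>q. c * ln (cmod q) - W (m - (n + int r)) q) = (\<lambda>q. c * ln (cmod q) - W (m - n) q)" for n
    using periodic_todaD(1)[OF assms, of "m - n - int r"] by (simp add: algebra_simps)
  show "continuous_on (- {0}) (\<lambda>q. c * ln (cmod q) - W (m - n) q)" for n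
    by (intro continuous_intros periodic_todaD(2)[OF assms]) auto
  show "has_laplacian (\<lambda>q. c * ln (cmod q) - W (m - n) q) q (2 * (real r)\<^sup>2 *
      (exp (2 * (c * ln (cmod q) - W (m - n) q - (c * ln (cmod q) - W (m - (n - 1)) q)))
       - exp (2 * (c * ln (cmod q) - W (m - (n + 1)) q - (c * ln (cmod q) - W (m - n) q)))))"
    if "q \<noteq> 0" for n q
    using has_laplacian_diff[OF has_laplacian_cmult[OF has_laplacian_ln_cmod[OF that]]
        periodic_todaD(3)[OF assms that], of c "m - n"]
    by (simp add: algebra_simps)
qed

section \<open>A Keller-Osserman bound\<close>

text \<open>Jensen's inequality for exp with weights \<open>x n\<close>, proved from the tangent
  line at the weighted mean \<open>y\<close>. With \<open>x\<close> the values of the X_n at a fixed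
  point and \<open>d\<close> the changes of ln X_n, the right side becomes f ln (f(q) / f), where f
  is the sum at the fixed point.\<close>

lemma gibbs_inequality:
  fixes x d :: "'a \<Rightarrow> real"
  assumes "finite S" "\<And>n. n \<in> S \<Longrightarrow> 0 \<le> x n" "(\<Sum>n\<in>S. x n) > 0"
  shows "(\<Sum>n\<in>S. x n * d n) \<le> (\<Sum>n\<in>S. x n) * ln ((\<Sum>n\<in>S. x n * exp (d n)) / (\<Sum>n\<in>S. x n))"
proof -
  define f where "f = (\<Sum>n\<in>S. x n)"
  define y where "y = (\<Sum>n\<in>S. x n * d n) / f"
  have f: "f > 0" using assms f_def by simp
  have "f * exp y = exp y * (\<Sum>n\<in>S. x n * (1 + (d n - y)))"
  proof -
    have "(\<Sum>n\<in>S. x n * (1 + (d n - y))) = (\<Sum>n\<in>S. x n) + (\<Sum>n\<in>S. x n * d n) - (\<Sum>n\<in>S. x n) * y"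
      by (simp add: sum.distrib sum_subtractf sum_distrib_right distrib_left right_diff_distrib)
    also have "\<dots> = f" using f by (simp add: f_def[symmetric] y_def)
    finally show ?thesis by simp
  qed
  also have "\<dots> \<le> exp y * (\<Sum>n\<in>S. x n * exp (d n - y))"
    using assms by (intro mult_left_mono sum_mono exp_ge_add_one_self) auto
  also have "\<dots> = (\<Sum>n\<in>S. x n * exp (d n))"
    by (simp add: sum_distrib_left exp_diff)
  finally have le: "exp y \<le> (\<Sum>n\<in>S. x n * exp (d n)) / f"
    using f by (simp add: field_simps)
  have "y \<le> ln ((\<Sum>n\<in>S. x n * exp (d n)) / f)"
    using le by (metis exp_gt_zero ln_exp ln_le_cancel_iff order_less_le_trans)
  then have "f * y \<le> f * ln ((\<Sum>n\<in>S. x n * exp (d n)) / f)"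
    using f by simp
  then show ?thesis using f by (simp add: y_def f_def)
qed

text \<open>An entry at most 1 lets the energy control the largest entry: the oscillation is at
  least m - 1, and by Cauchy-Schwarz its square is at most r times the energy. The energy thus grows
  quadratically in \<open>f\<close>, while the hypothesis allows only linear growth.\<close>

lemma sum_le_of_energy_le:
  fixes X :: "int \<Rightarrow> real"
  assumes r: "r \<ge> 1" and j: "j \<in> {1..int r}" "X j \<le> 1"
    and pos: "\<And>n. n \<in> {1..int r} \<Longrightarrow> X n > 0"
    and f: "f = (\<Sum>n\<in>{1..int r}. X n)"
    and A: "0 < A" "A \<le> 1"
    and energy: "4 * (real r)\<^sup>2 * (\<Sum>n\<in>{1..int r}. (X n - X (n - 1))\<^sup>2) \<le> 8 * f / A\<^sup>2"
  shows "f * A\<^sup>2 \<le> 8 * real r"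
proof -
  define m where "m = Max (X ` {1..int r})"
  have ne: "{1..int r} \<noteq> {}" using r by auto
  have "m \<in> X ` {1..int r}" unfolding m_def using ne by (intro Max_in) auto
  then obtain i where i: "i \<in> {1..int r}" "m = X i" by auto
  have le: "X n \<le> m" if "n \<in> {1..int r}" for n unfolding m_def using that by (intro Max_ge) auto
  have fm: "f \<le> real r * m"
    using sum_bounded_above[of "{1..int r}" X m] le by (simp add: f)
  have fpos: "f > 0" unfolding f using pos ne by (intro sum_pos) auto
  have A2: "A\<^sup>2 \<le> 1" using A by (simp add: power_le_one)
  show ?thesis
  \<comment> \<open>For m > 2 the loss of 1 is harmless, since m - 1 >= m / 2.\<close>
  proof (cases "m \<le> 2")
    case True
    have "f * A\<^sup>2 \<le> f * 1" using A2 fpos by (intro mult_left_mono) auto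
    also have "\<dots> \<le> real r * 2" using fm True mult_left_mono[OF True, of "real r"] by simp
    finally show ?thesis by simp
  next
    case False
    define E where "E = (\<Sum>n\<in>{1..int r}. (X n - X (n - 1))\<^sup>2)"
    have "m - 1 \<le> \<bar>X i - X j\<bar>" using i j by simp
    also have "\<dots> \<le> (\<Sum>n\<in>{1..int r}. \<bar>X n - X (n - 1)\<bar>)"
      by (rule diff_le_sum_abs_steps[OF i(1) j(1)])
    finally have "(m - 1)\<^sup>2 \<le> (\<Sum>n\<in>{1..int r}. \<bar>X n - X (n - 1)\<bar>)\<^sup>2"
      using False by (intro power_mono) auto
    also have "\<dots> \<le> E * real r"
      using Cauchy_Schwarz_ineq_sum[of "\<lambda>n. \<bar>X n - X (n - 1)\<bar>" "\<lambda>_. 1" "{1..int r}"]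
      by (simp add: E_def)
    finally have "(m - 1)\<^sup>2 \<le> E * real r" .
    moreover have "(m / 2)\<^sup>2 \<le> (m - 1)\<^sup>2" using False by (intro power_mono) auto
    ultimately have "m\<^sup>2 \<le> 4 * E * real r" by (simp add: power_divide)
    then have "real r * m\<^sup>2 \<le> 4 * (real r)\<^sup>2 * E"
      using mult_left_mono[of "m\<^sup>2" "4 * E * real r" "real r"]
      by (simp add: power2_eq_square algebra_simps)
    also have "\<dots> \<le> 8 * f / A\<^sup>2" using energy by (simp add: E_def)
    finally have *: "real r * m\<^sup>2 \<le> 8 * f / A\<^sup>2" .
    have "f\<^sup>2 \<le> (real r * m)\<^sup>2" using fm fpos by (intro power_mono) auto
    also have "\<dots> = real r * (real r * m\<^sup>2)" by (simp add: power2_eq_square)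
    also have "\<dots> \<le> real r * (8 * f / A\<^sup>2)" by (intro mult_left_mono *) auto
    finally have "f * (f * A\<^sup>2) \<le> f * (8 * real r)"
      using A(1) by (simp add: field_simps power2_eq_square)
    then show ?thesis using fpos by simp
  qed
qed

text \<open>The Ahlfors-Schwarz argument on the unit disc around \<open>p\<close>, which misses 0
  because |p| > 1. The weight (1 - |q - p|^2)^2 is the inverse Poincare density up to a factor. It
  equals 1 at \<open>p\<close>, so a bound on the weighted maximum bounds f(p).\<close>

lemma periodic_toda_sum_exp_le:
  assumes W: "periodic_toda r W" and r: "r \<ge> 1" and p: "cmod p > 1"
  shows "(\<Sum>n\<in>{1..int r}. exp (2 * (W n p - W (n - 1) p))) \<le> 8 * real r"
proof -
  define S where "S = {1..int r}"
  define X where "X = (\<lambda>q n. exp (2 * (W n q - W (n - 1) q)))"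
  define f where "f = (\<lambda>q. \<Sum>n\<in>S. X q n)"
  have S: "finite S" "S \<noteq> {}" using r by (auto simp: S_def)
  have f_pos: "f q > 0" for q unfolding f_def X_def using S by (intro sum_pos) auto
  have nz: "q \<noteq> 0" if "cmod (q - p) \<le> 1" for q
    using that p by (metis diff_0 norm_minus_cancel not_le)
  have "continuous_on (cball p 1) (W n)" for n
    by (rule continuous_on_subset[OF periodic_todaD(2)[OF W]])
      (use p in auto)
  then have "continuous_on (cball p 1) (\<lambda>q. f q * (1 - (cmod (q - p))\<^sup>2)\<^sup>2)"
    unfolding f_def X_def by (intro continuous_intros) auto
  then obtain q0 where q0: "q0 \<in> cball p 1"
    "\<And>q. q \<in> cball p 1 \<Longrightarrow>
       f q * (1 - (cmod (q - p))\<^sup>2)\<^sup>2 \<le> f q0 * (1 - (cmod (q0 - p))\<^sup>2)\<^sup>2"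
    using continuous_attains_sup[of "cball p 1" "\<lambda>q. f q * (1 - (cmod (q - p))\<^sup>2)\<^sup>2"] by auto
  have fp: "f p \<le> f q0 * (1 - (cmod (q0 - p))\<^sup>2)\<^sup>2" using q0(2)[of p] by simp
  \<comment> \<open>The weighted function vanishes on the boundary circle and is positive at
    \<open>p\<close>, so its maximum is interior.\<close>
  have "cmod (q0 - p) \<noteq> 1" using fp f_pos[of p] by auto
  then have lt: "cmod (q0 - p) < 1" using q0(1) by (simp add: dist_norm norm_minus_commute)
  define A where "A = 1 - (cmod (q0 - p))\<^sup>2"
  have A: "0 < A" "A \<le> 1" using lt by (auto simp: A_def abs_square_less_1)
  have q0nz: "q0 \<noteq> 0" using nz lt by simp
  \<comment> \<open>By Gibbs' inequality the following function touches
    \<open>f q0 * ln (f q * (1 - \<bar>q - p\<bar>\<^sup>2)\<^sup>2)\<close> from below at \<open>q0\<close>, up to a constant.\<close>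
  define G where "G = (\<lambda>q. (\<Sum>n\<in>S. X q0 n * (2 * (W n q - W (n - 1) q)))
                          + 2 * f q0 * ln (1 - (cmod (q - p))\<^sup>2))"
  have "\<forall>\<^sub>F q in nhds q0. q \<in> ball p 1"
    using lt by (intro eventually_nhds_in_open) (auto simp: dist_norm norm_minus_commute)
  then have "\<forall>\<^sub>F q in nhds q0. G q \<le> G q0"
  proof eventually_elim
    case (elim q)
    define B where "B = 1 - (cmod (q - p))\<^sup>2"
    have B: "B > 0" using elim by (auto simp: B_def abs_square_less_1 dist_norm norm_minus_commute)
    have "f q * B\<^sup>2 \<le> f q0 * A\<^sup>2" using q0(2)[of q] elim by (auto simp: A_def B_def)
    then have "ln (f q * B\<^sup>2) \<le> ln (f q0 * A\<^sup>2)"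
      using f_pos A B by (subst ln_le_cancel_iff) auto
    then have ln: "ln (f q / f q0) \<le> 2 * ln A - 2 * ln B"
      using f_pos[of q] f_pos[of q0] A B by (simp add: ln_mult ln_div ln_realpow)
    have "(\<Sum>n\<in>S. X q0 n * (2 * (W n q - W (n - 1) q) - 2 * (W n q0 - W (n - 1) q0)))
        \<le> (\<Sum>n\<in>S. X q0 n) * ln ((\<Sum>n\<in>S. X q0 n *
            exp (2 * (W n q - W (n - 1) q) - 2 * (W n q0 - W (n - 1) q0))) / (\<Sum>n\<in>S. X q0 n))"
      by (rule gibbs_inequality) (use S f_pos[of q0] in \<open>auto simp: X_def f_def\<close>)
    also have "\<dots> = f q0 * ln (f q / f q0)"
      by (simp add: f_def X_def exp_diff)
    also have "\<dots> \<le> f q0 * (2 * ln A - 2 * ln B)"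
      using ln f_pos[of q0] by (intro mult_left_mono) auto
    finally show ?case
      by (simp add: G_def A_def[symmetric] B_def[symmetric] sum_subtractf right_diff_distrib)
  qed
  moreover have "has_laplacian G q0
      ((\<Sum>n\<in>S. X q0 n * (2 * (2 * (real r)\<^sup>2 * (X q0 n - X q0 (n + 1))
                           - 2 * (real r)\<^sup>2 * (X q0 (n - 1) - X q0 n))))
       + 2 * f q0 * (- 4 / A\<^sup>2))"
  proof -
    have "has_laplacian (\<lambda>q. W n q - W (n - 1) q) q0
       (2 * (real r)\<^sup>2 * (X q0 n - X q0 (n + 1)) - 2 * (real r)\<^sup>2 * (X q0 (n - 1) - X q0 n))" for n
      using has_laplacian_diff[OF periodic_todaD(3)[OF W q0nz] periodic_todaD(3)[OF W q0nz], of n "n - 1"]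
      by (simp add: X_def)
    then show ?thesis
      unfolding G_def A_def
      by (intro has_laplacian_add has_laplacian_sum has_laplacian_cmult S
        has_laplacian_ln_one_minus_dist lt)
  qed
  ultimately have "(\<Sum>n\<in>S. X q0 n * (2 * (2 * (real r)\<^sup>2 * (X q0 n - X q0 (n + 1))
         - 2 * (real r)\<^sup>2 * (X q0 (n - 1) - X q0 n)))) + 2 * f q0 * (- 4 / A\<^sup>2) \<le> 0"
    by (rule has_laplacian_nonpos_at_local_max[rotated])
  \<comment> \<open>Summation by parts: the left side pairs X with the discrete Laplacian of the
    cycle, which yields the Dirichlet energy.\<close>
  moreover have "(\<Sum>n\<in>S. X q0 n * (2 * (2 * (real r)\<^sup>2 * (X q0 n - X q0 (n + 1))
         - 2 * (real r)\<^sup>2 * (X q0 (n - 1) - X q0 n)))) = 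
      4 * (real r)\<^sup>2 * (\<Sum>n\<in>S. (X q0 n - X q0 (n - 1))\<^sup>2)"
  proof -
    have per: "X q0 (n + int r) = X q0 n" for n
      using periodic_todaD(1)[OF W, of n] periodic_todaD(1)[OF W, of "n - 1"]
      by (simp add: X_def algebra_simps)
    have e1: "(\<Sum>n\<in>S. X q0 n * X q0 (n + 1)) = (\<Sum>n\<in>S. X q0 (n - 1) * X q0 n)"
      using periodic_sum_shift1[of "\<lambda>n. X q0 n * X q0 (n + 1)" r] per per[of "_ + 1"]
      by (simp add: S_def ac_simps)
    have e2: "(\<Sum>n\<in>S. X q0 (n - 1) * X q0 (n - 1)) = (\<Sum>n\<in>S. X q0 n * X q0 n)"
      using periodic_sum_shift1[of "\<lambda>n. X q0 n * X q0 n" r] per by (simp add: S_def)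
    have "(\<Sum>n\<in>S. X q0 n * (2 * (2 * (real r)\<^sup>2 * (X q0 n - X q0 (n + 1))
         - 2 * (real r)\<^sup>2 * (X q0 (n - 1) - X q0 n))))
       = 4 * (real r)\<^sup>2 * (2 * (\<Sum>n\<in>S. X q0 n * X q0 n) - (\<Sum>n\<in>S. X q0 n * X q0 (n + 1))
            - (\<Sum>n\<in>S. X q0 (n - 1) * X q0 n))"
      unfolding sum_distrib_left sum_subtractf[symmetric]
      by (intro sum.cong) (auto simp: algebra_simps)
    also have "\<dots> = 4 * (real r)\<^sup>2 * ((\<Sum>n\<in>S. X q0 n * X q0 n) + (\<Sum>n\<in>S. X q0 (n - 1) * X q0 (n - 1))
            - 2 * (\<Sum>n\<in>S. X q0 (n - 1) * X q0 n))"
      using e1 e2 by simp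
    also have "\<dots> = 4 * (real r)\<^sup>2 * (\<Sum>n\<in>S. (X q0 n - X q0 (n - 1))\<^sup>2)"
      unfolding sum_distrib_left sum_subtractf[symmetric] sum.distrib[symmetric]
      by (intro sum.cong) (auto simp: algebra_simps power2_eq_square)
    finally show ?thesis .
  qed
  ultimately have energy: "4 * (real r)\<^sup>2 * (\<Sum>n\<in>S. (X q0 n - X q0 (n - 1))\<^sup>2) \<le> 8 * f q0 / A\<^sup>2"
    by simp
  \<comment> \<open>The cyclic product of the X_n is 1, so they cannot all exceed 1.\<close>
  have "(\<Sum>n\<in>S. W n q0 - W (n - 1) q0) = 0"
    using periodic_sum_shift1[of "\<lambda>n. W n q0" r] periodic_todaD(1)[OF W]
    by (simp add: S_def sum_subtractf)
  then obtain j where "j \<in> S" "W j q0 - W (j - 1) q0 \<le> 0"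
    using S sum_pos[of S "\<lambda>n. W n q0 - W (n - 1) q0"] by (metis less_irrefl not_le)
  then have "f q0 * A\<^sup>2 \<le> 8 * real r"
    using r energy A by (intro sum_le_of_energy_le[of r j "X q0"]) (auto simp: S_def X_def f_def)
  then show ?thesis using fp by (simp add: A_def f_def S_def X_def)
qed

section \<open>Uniqueness\<close>

text \<open>The bound on the sum of exponentials is one-sided. Since the increments over a period
  add up to 0, a lower bound follows by writing one increment as minus the sum of the
  others.\<close>

lemma periodic_toda_diff_bounded:
  assumes W: "periodic_toda r W" and r: "r \<ge> 1" and p: "cmod p > 1"
  shows "\<bar>W n p - W (n - 1) p\<bar> \<le> real r * ln (8 * real r)"
proof -
  define D where "D = (\<lambda>n. W n p - W (n - 1) p)"
  define S where "S = {1..int r}"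
  define K where "K = ln (8 * real r)"
  have K: "K \<ge> 0" unfolding K_def using r by simp
  have per: "W (n + int r) = W n" for n by (rule periodic_todaD(1)[OF W])
  have upper: "D n \<le> K" if "n \<in> S" for n
  proof -
    have "exp (2 * D n) \<le> (\<Sum>n\<in>S. exp (2 * D n))"
      using that by (intro member_le_sum) (auto simp: S_def)
    also have "\<dots> \<le> 8 * real r"
      using periodic_toda_sum_exp_le[OF W r p] by (simp add: S_def D_def)
    finally have "2 * D n \<le> K"
      unfolding K_def using r by (subst ln_ge_iff) auto
    then show ?thesis using K by linarith
  qed
  have sum0: "(\<Sum>n\<in>S. D n) = 0"
    using periodic_sum_shift1[of "\<lambda>n. W n p" r] per by (simp add: S_def D_def sum_subtractf)
  have bound: "\<bar>D n\<bar> \<le> real r * K" if "n \<in> S" for n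
  proof -
    have "K \<le> real r * K" using mult_right_mono[of 1 "real r" K] r K by simp
    moreover have "(\<Sum>m\<in>S - {n}. D m) \<le> real (card (S - {n})) * K"
      by (rule sum_bounded_above) (use upper in auto)
    moreover have "real (card (S - {n})) * K \<le> real r * K"
      using K card_Diff1_le[of S n] by (intro mult_right_mono) (auto simp: S_def)
    moreover have "D n = - (\<Sum>m\<in>S - {n}. D m)"
      using sum0 sum.remove[of S n D] that by (simp add: S_def)
    ultimately show ?thesis using upper[OF that] by linarith
  qed
  have "D (m + int r) = D m" for m
    using per[of m] per[of "m - 1"] by (simp add: D_def algebra_simps)
  then obtain m where "m \<in> S" "D n = D m"
    unfolding S_def using periodic_exists_index[of D r n] r by blast
  then show ?thesis using bound[of m] by (simp add: D_def K_def)
qed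

text \<open>With mean zero, \<open>u n\<close> is the average of its differences to all entries, and
  each such difference is a sum of fewer than \<open>r\<close> steps.\<close>

lemma sum_zero_abs_le:
  fixes u :: "int \<Rightarrow> real"
  assumes sum0: "(\<Sum>n\<in>{1..int r}. u n) = 0" and n: "n \<in> {1..int r}"
    and step: "\<And>n. \<bar>u n - u (n - 1)\<bar> \<le> K"
  shows "\<bar>u n\<bar> \<le> real r * K"
proof -
  have "\<bar>u n - u m\<bar> \<le> real r * K" if "m \<in> {1..int r}" for m
    using diff_le_sum_abs_steps[OF n that, of u]
      sum_bounded_above[of "{1..int r}" "\<lambda>n. \<bar>u n - u (n - 1)\<bar>" K] step by simp
  then have "(\<Sum>m\<in>{1..int r}. \<bar>u n - u m\<bar>) \<le> real r * (real r * K)"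
    using sum_bounded_above[of "{1..int r}" "\<lambda>m. \<bar>u n - u m\<bar>" "real r * K"] by simp
  moreover have "real r * \<bar>u n\<bar> = \<bar>\<Sum>m\<in>{1..int r}. u n - u m\<bar>"
    using sum0 by (simp add: sum_subtractf abs_mult)
  ultimately have "real r * \<bar>u n\<bar> \<le> real r * (real r * K)"
    using sum_abs[of "\<lambda>m. u n - u m" "{1..int r}"] by linarith
  then show ?thesis using n by auto
qed

lemma exp_diff_mult_nonneg:
  fixes a b :: real
  shows "0 \<le> (a - b) * (exp (2 * a) - exp (2 * b))"
    and "a \<noteq> b \<Longrightarrow> 0 < (a - b) * (exp (2 * a) - exp (2 * b))"
proof -
  show *: "0 < (a - b) * (exp (2 * a) - exp (2 * b))" if "a \<noteq> b"
    using that by (cases "a < b") (auto intro: mult_neg_neg mult_pos_pos)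
  show "0 \<le> (a - b) * (exp (2 * a) - exp (2 * b))"
    using * by (cases "a = b") (auto intro: less_imp_le)
qed

text \<open>The Euclidean norm fits the equation: pairing the Laplacian of the difference with the
  difference itself and summing by parts produces products of the form (a - b)(exp 2a - exp 2b),
  which are nonnegative.\<close>

definition toda_dist :: "nat \<Rightarrow> (int \<Rightarrow> complex \<Rightarrow> real) \<Rightarrow> (int \<Rightarrow> complex \<Rightarrow> real) \<Rightarrow> complex \<Rightarrow> real" where
  "toda_dist r W V q = L2_set (\<lambda>n. W n q - V n q) {1..int r}"

text \<open>A maximum makes a sum of nonnegative monotonicity products nonpositive, so each product
  vanishes. Hence the difference of the families is constant in n, and equal sums force the constant
  to be 0. The term with \<open>s\<close> is harmonic, which leaves it free for use as a
  barrier.\<close>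

lemma toda_dist_zero_at_local_max:
  assumes W: "periodic_toda r W" and V: "periodic_toda r V" and r: "r \<ge> 1" and q0: "q0 \<noteq> 0"
    and sum_eq: "(\<Sum>n\<in>{1..int r}. W n q0) = (\<Sum>n\<in>{1..int r}. V n q0)"
    and max: "\<forall>\<^sub>F q in nhds q0. toda_dist r W V q - s * ln (cmod q)
                              \<le> toda_dist r W V q0 - s * ln (cmod q0)"
  shows "toda_dist r W V q0 = 0"
proof (rule ccontr)
  assume nonzero: "toda_dist r W V q0 \<noteq> 0"
  define S where "S = {1..int r}"
  have S: "finite S" by (simp add: S_def)
  define u where "u = (\<lambda>q n. W n q - V n q)"
  define N where "N = toda_dist r W V"
  have N: "N q = L2_set (u q) S" for q by (simp add: N_def u_def S_def toda_dist_def)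
  have Npos: "N q0 > 0"
    using nonzero L2_set_nonneg[of "u q0" S] N[of q0] unfolding N_def by linarith
  define E where "E = (\<lambda>n. exp (2 * (W n q0 - W (n - 1) q0)) - exp (2 * (V n q0 - V (n - 1) q0)))"
  define u0 where "u0 = u q0"
  \<comment> \<open>The norm is the supremum of the linear functionals given by unit vectors, so
    \<open>toda_dist\<close> may be replaced near \<open>q0\<close> by the one attaining it there.\<close>
  define G where "G = (\<lambda>q. (\<Sum>n\<in>S. u0 n * (W n q - V n q)) - N q0 * s * ln (cmod q))"
  have "\<forall>\<^sub>F q in nhds q0. G q \<le> G q0"
    using max
  proof eventually_elim
    case (elim q)
    have "(\<Sum>n\<in>S. u0 n * (W n q - V n q)) \<le> (\<Sum>n\<in>S. \<bar>u0 n\<bar> * \<bar>u q n\<bar>)"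
      unfolding u_def abs_mult[symmetric] by (intro sum_mono) auto
    also have "\<dots> \<le> N q0 * N q"
      unfolding N u0_def by (rule L2_set_mult_ineq)
    finally have "G q \<le> N q0 * (N q - s * ln (cmod q))"
      by (simp add: G_def algebra_simps)
    also have "\<dots> \<le> N q0 * (N q0 - s * ln (cmod q0))"
      using elim Npos by (intro mult_left_mono) (auto simp: N_def)
    also have "\<dots> = G q0"
    proof -
      have "N q0 * N q0 = (\<Sum>n\<in>S. u0 n * u0 n)"
        using N[of q0] by (simp add: L2_set_def u0_def sum_nonneg flip: power2_eq_square)
      then show ?thesis by (simp add: G_def u0_def u_def algebra_simps)
    qed
    finally show ?case .
  qed
  moreover have "has_laplacian G q0
      ((\<Sum>n\<in>S. u0 n * (2 * (real r)\<^sup>2 * (E n - E (n + 1)))) - N q0 * s * 0)"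
    unfolding G_def
  proof (intro has_laplacian_diff[of _ _ _ "\<lambda>q. N q0 * s * ln (cmod q)"] has_laplacian_sum
      has_laplacian_cmult S has_laplacian_ln_cmod q0)
    show "has_laplacian (\<lambda>q. W n q - V n q) q0 (2 * (real r)\<^sup>2 * (E n - E (n + 1)))" for n
      using has_laplacian_diff[OF periodic_todaD(3)[OF W q0, of n] periodic_todaD(3)[OF V q0, of n]]
      by (simp add: E_def algebra_simps)
  qed
  ultimately have "(\<Sum>n\<in>S. u0 n * (2 * (real r)\<^sup>2 * (E n - E (n + 1)))) \<le> 0"
    using has_laplacian_nonpos_at_local_max by fastforce
  moreover have "(\<Sum>n\<in>S. u0 n * (2 * (real r)\<^sup>2 * (E n - E (n + 1))))
      = 2 * (real r)\<^sup>2 * (\<Sum>n\<in>S. (u0 n - u0 (n - 1)) * E n)"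
  proof -
    have per: "u0 (n + int r) = u0 n" "E (n + int r) = E n" for n
      using periodic_todaD(1)[OF W, of n] periodic_todaD(1)[OF W, of "n - 1"]
        periodic_todaD(1)[OF V, of n] periodic_todaD(1)[OF V, of "n - 1"]
      by (simp_all add: u0_def u_def E_def algebra_simps)
    have "(\<Sum>n\<in>S. u0 (n - 1) * E n) = (\<Sum>n\<in>S. u0 n * E (n + 1))"
      using periodic_sum_shift1[of "\<lambda>n. u0 n * E (n + 1)" r] per(1) per(2)[of "_ + 1"]
      by (simp add: S_def ac_simps)
    moreover have "(\<Sum>n\<in>S. u0 n * (2 * (real r)\<^sup>2 * (E n - E (n + 1))))
      = 2 * (real r)\<^sup>2 * ((\<Sum>n\<in>S. u0 n * E n) - (\<Sum>n\<in>S. u0 n * E (n + 1)))"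
      unfolding sum_distrib_left sum_subtractf[symmetric]
      by (intro sum.cong) (auto simp: algebra_simps)
    ultimately show ?thesis by (simp add: left_diff_distrib sum_subtractf)
  qed
  ultimately have le: "(\<Sum>n\<in>S. (u0 n - u0 (n - 1)) * E n) \<le> 0"
    using r by (simp add: mult_le_0_iff)
  have E_u0: "(u0 n - u0 (n - 1)) * E n =
      ((W n q0 - W (n - 1) q0) - (V n q0 - V (n - 1) q0)) *
      (exp (2 * (W n q0 - W (n - 1) q0)) - exp (2 * (V n q0 - V (n - 1) q0)))" for n
    by (simp add: E_def u0_def u_def algebra_simps)
  have "(u0 n - u0 (n - 1)) * E n = 0" if "n \<in> S" for n
    using sum_nonneg_0[of S "\<lambda>n. (u0 n - u0 (n - 1)) * E n"] that le S exp_diff_mult_nonneg(1)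
    unfolding E_u0 by (metis (no_types, lifting) order_antisym sum_nonneg)
  then have eq: "u0 n - u0 (n - 1) = 0" if "n \<in> S" for n
    using exp_diff_mult_nonneg(2)[of "W n q0 - W (n - 1) q0" "V n q0 - V (n - 1) q0"] that
    unfolding E_u0 by (force simp: u0_def u_def)
  have const: "u0 n = u0 m" if "n \<in> S" "m \<in> S" for n m
    using diff_le_sum_abs_steps[of n r m u0] that eq by (simp add: S_def)
  have sum0: "(\<Sum>n\<in>S. u0 n) = 0" using sum_eq by (simp add: u0_def u_def S_def sum_subtractf)
  have "u0 n = 0" if "n \<in> S" for n
  proof -
    have "(\<Sum>m\<in>S. u0 m) = (\<Sum>m\<in>S. u0 n)"
      by (intro sum.cong refl const that)
    then show ?thesis using sum0 r by (simp add: S_def)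
  qed
  then have "N q0 = 0" using N[of q0] by (simp add: L2_set_def u0_def)
  then show False using Npos by simp
qed

text \<open>Comparison with the harmonic barrier M + s ln |q|. A maximum of the gap lies on the
  boundary or at an interior point where the distance is 0; there nonnegativity of the barrier takes
  over.\<close>

lemma toda_dist_le_on_annulus:
  assumes W: "periodic_toda r W" and V: "periodic_toda r V" and r: "r \<ge> 1"
    and sum_eq: "\<And>q. q \<noteq> 0 \<Longrightarrow> (\<Sum>n\<in>{1..int r}. W n q) = (\<Sum>n\<in>{1..int r}. V n q)"
    and R: "0 < R1" "R1 \<le> cmod q" "cmod q \<le> R2"
    and bdry: "\<And>q. cmod q = R1 \<or> cmod q = R2 \<Longrightarrow> toda_dist r W V q \<le> M + s * ln (cmod q)"
    and nonneg: "\<And>q. R1 \<le> cmod q \<Longrightarrow> cmod q \<le> R2 \<Longrightarrow> 0 \<le> M + s * ln (cmod q)"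
  shows "toda_dist r W V q \<le> M + s * ln (cmod q)"
proof -
  define N where "N = toda_dist r W V"
  define A where "A = cball 0 R2 - ball (0::complex) R1"
  have A: "x \<in> A \<longleftrightarrow> R1 \<le> cmod x \<and> cmod x \<le> R2" for x by (auto simp: A_def)
  have "compact A" unfolding A_def by (intro compact_diff) auto
  have "A \<subseteq> - {0}" using R(1) A by auto
  then have cont: "continuous_on A (W n)" "continuous_on A (V n)" for n
    using periodic_todaD(2)[OF W] periodic_todaD(2)[OF V] continuous_on_subset by blast+
  have "continuous_on A (\<lambda>q. N q - s * ln (cmod q))"
    unfolding N_def toda_dist_def L2_set_def
    using \<open>A \<subseteq> - {0}\<close> by (intro continuous_intros cont) auto
  moreover have "q \<in> A" using R A by auto
  ultimately obtain q0 where q0: "q0 \<in> A"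
    "\<And>q. q \<in> A \<Longrightarrow> N q - s * ln (cmod q) \<le> N q0 - s * ln (cmod q0)"
    using continuous_attains_sup[of A] \<open>compact A\<close> by blast
  have "N q0 - s * ln (cmod q0) \<le> M"
  proof (cases "cmod q0 = R1 \<or> cmod q0 = R2")
    case True
    then show ?thesis using bdry[of q0] by (simp add: N_def)
  next
    case False
    then have "q0 \<in> ball 0 R2 - cball 0 R1" using q0(1) A by auto
    then have "\<forall>\<^sub>F q in nhds q0. q \<in> ball 0 R2 - cball 0 R1"
      by (intro eventually_nhds_in_open) auto
    then have "\<forall>\<^sub>F q in nhds q0. N q - s * ln (cmod q) \<le> N q0 - s * ln (cmod q0)"
      by eventually_elim (use q0(2) A in auto)
    moreover have "q0 \<noteq> 0" using q0(1) A R(1) by auto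
    ultimately have "N q0 = 0"
      using toda_dist_zero_at_local_max[OF W V r _ sum_eq] unfolding N_def by blast
    then show ?thesis using nonneg[of q0] q0(1) A by simp
  qed
  then show ?thesis using q0(2)[OF \<open>q \<in> A\<close>] by (simp add: N_def)
qed

theorem periodic_toda_unique:
  assumes W: "periodic_toda r W" and V: "periodic_toda r V" and r: "r \<ge> 1"
    and sum_eq: "\<And>q. q \<noteq> 0 \<Longrightarrow> (\<Sum>n\<in>{1..int r}. W n q) = (\<Sum>n\<in>{1..int r}. V n q)"
    and asym: "\<And>n. n \<in> {1..int r} \<Longrightarrow> (\<lambda>q. W n q - V n q) \<in> o[at 0](\<lambda>q. ln (cmod q))"
    and q: "q \<noteq> 0"
  shows "W n q = V n q"
proof -
  define N where "N = toda_dist r W V"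
  have N_nonneg: "N q \<ge> 0" for q unfolding N_def toda_dist_def by (rule L2_set_nonneg)
  have N_le: "N q \<le> (\<Sum>n\<in>{1..int r}. \<bar>W n q - V n q\<bar>)" for q
    unfolding N_def toda_dist_def by (rule L2_set_le_sum_abs)
  \<comment> \<open>Each increment of the difference is at most 2 r ln (8r). One factor
    \<open>r\<close> passes from increments to entries, the other from entries to the norm.\<close>
  define C where "C = real r * (real r * (2 * (real r * ln (8 * real r))))"
  have bounded: "N q \<le> C" if "cmod q > 1" for q
  proof -
    have "q \<noteq> 0" using that by auto
    have "\<bar>(W n q - V n q) - (W (n - 1) q - V (n - 1) q)\<bar> \<le> 2 * (real r * ln (8 * real r))" for n
      using periodic_toda_diff_bounded[OF W r that, of n] periodic_toda_diff_bounded[OF V r that, of n]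
      by linarith
    moreover have "(\<Sum>n\<in>{1..int r}. W n q - V n q) = 0"
      using sum_eq[OF \<open>q \<noteq> 0\<close>] by (simp add: sum_subtractf)
    ultimately have "\<bar>W n q - V n q\<bar> \<le> real r * (2 * (real r * ln (8 * real r)))"
      if "n \<in> {1..int r}" for n
      using sum_zero_abs_le[of "\<lambda>n. W n q - V n q" r n] that by blast
    then show ?thesis
      using sum_bounded_above[of "{1..int r}" "\<lambda>n. \<bar>W n q - V n q\<bar>"] N_le[of q]
      by (fastforce simp: C_def)
  qed
  have "continuous_on (sphere 0 1) (W n)" "continuous_on (sphere 0 1) (V n)" for n
    by (rule continuous_on_subset[OF periodic_todaD(2)[OF W]], auto)
      (rule continuous_on_subset[OF periodic_todaD(2)[OF V]], auto)
  then have "continuous_on (sphere 0 1) N"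
    unfolding N_def toda_dist_def L2_set_def by (intro continuous_intros)
  then obtain q1 where q1: "cmod q1 = 1" "\<And>q. cmod q = 1 \<Longrightarrow> N q \<le> N q1"
    using continuous_attains_sup[of "sphere (0::complex) 1" N] by force
  \<comment> \<open>The maximum over the unit circle; the circle separates the two ends, and ln |q|
    vanishes on it.\<close>
  define M where "M = N q1"
  have M: "M \<ge> 0" unfolding M_def by (rule N_nonneg)
  note annulus = toda_dist_le_on_annulus[OF W V r sum_eq, folded N_def]
  have outer: "N q \<le> M + \<epsilon> * ln (cmod q)" if "cmod q \<ge> 1" "\<epsilon> > 0" for q \<epsilon>
  proof -
    \<comment> \<open>The exponential makes the barrier exceed \<open>C\<close> on the outer circle;
      the other entry keeps \<open>q\<close> inside and R > 1, where \<open>bounded\<close>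
      applies.\<close>
    define R where "R = max (cmod q + 1) (exp (C / \<epsilon>))"
    have R: "R \<ge> cmod q" "R > 1" "C \<le> \<epsilon> * ln R"
    proof -
      show "R \<ge> cmod q" "R > 1" using that by (auto simp: R_def)
      then have "C / \<epsilon> \<le> ln R" by (subst ln_ge_iff) (auto simp: R_def)
      then show "C \<le> \<epsilon> * ln R" using that by (simp add: field_simps)
    qed
    show ?thesis
    proof (rule annulus[of 1 q R])
      fix x :: complex
      assume "cmod x = 1 \<or> cmod x = R"
      then show "N x \<le> M + \<epsilon> * ln (cmod x)"
        using q1(2)[of x] bounded[of x] R M by (auto simp: M_def)
    qed (use that R M in auto)
  qed
  have inner: "N q \<le> M + (- \<epsilon>) * ln (cmod q)" if "cmod q \<le> 1" "q \<noteq> 0" "\<epsilon> > 0" for q \<epsilon>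
  proof -
    \<comment> \<open>The share \<epsilon> / r per index adds up to \<epsilon> in the bound of the
      norm by the sum of absolute values.\<close>
    have "\<forall>\<^sub>F x in at 0. \<forall>n\<in>{1..int r}. \<bar>W n x - V n x\<bar> \<le> \<epsilon> / real r * \<bar>ln (cmod x)\<bar>"
      using landau_o.smallD[OF asym, of _ "\<epsilon> / real r"] that r
      by (intro eventually_ball_finite) auto
    then obtain d where d: "d > 0" "\<And>x n. x \<noteq> 0 \<Longrightarrow> cmod x < d \<Longrightarrow> n \<in> {1..int r} \<Longrightarrow>
        \<bar>W n x - V n x\<bar> \<le> \<epsilon> / real r * \<bar>ln (cmod x)\<bar>"
      unfolding eventually_at by (auto simp: dist_norm)
    define R where "R = min (d / 2) (cmod q)"
    have R: "0 < R" "R \<le> cmod q" "R \<le> 1" "R < d" using d(1) that by (auto simp: R_def)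
    show ?thesis
    proof (rule annulus[of R q 1])
      fix x :: complex
      assume "cmod x = R \<or> cmod x = 1"
      then show "N x \<le> M + (- \<epsilon>) * ln (cmod x)"
      proof
        assume x: "cmod x = R"
        have "N x \<le> real r * (\<epsilon> / real r * \<bar>ln (cmod x)\<bar>)"
          using N_le[of x] R x d(2)[of x]
            sum_bounded_above[of "{1..int r}" "\<lambda>n. \<bar>W n x - V n x\<bar>" "\<epsilon> / real r * \<bar>ln (cmod x)\<bar>"]
          by fastforce
        also have "\<dots> = (- \<epsilon>) * ln (cmod x)" using x R r by simp
        finally show ?thesis using M by linarith
      qed (use q1(2)[of x] in \<open>simp add: M_def\<close>)
    next
      fix x :: complex
      assume "R \<le> cmod x" "cmod x \<le> 1"
      then have "ln (cmod x) \<le> 0" using R by (subst ln_le_zero_iff) auto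
      then show "0 \<le> M + (- \<epsilon>) * ln (cmod x)"
        using M mult_nonneg_nonpos[of \<epsilon> "ln (cmod x)"] \<open>\<epsilon> > 0\<close> by linarith
    qed (use that R in auto)
  qed
  have global: "N q \<le> M" if "q \<noteq> 0" for q
  proof (rule ccontr)
    assume "\<not> N q \<le> M"
    \<comment> \<open>Letting \<epsilon> tend to 0 at fixed \<open>q\<close>, made explicit. The
      summand 1 covers |q| = 1, and the factor 2 (|ln |q|| + 1) makes the resulting inequality
      strict.\<close>
    define \<epsilon> where "\<epsilon> = (N q - M) / (2 * (\<bar>ln (cmod q)\<bar> + 1))"
    have "\<epsilon> > 0" using \<open>\<not> N q \<le> M\<close> by (auto simp: \<epsilon>_def)
    have "N q \<le> M + \<epsilon> * \<bar>ln (cmod q)\<bar>"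
      using outer[of q \<epsilon>] inner[of q \<epsilon>] that \<open>\<epsilon> > 0\<close> by (cases "cmod q \<ge> 1") auto
    also have "\<dots> < M + \<epsilon> * (2 * (\<bar>ln (cmod q)\<bar> + 1))"
      using \<open>\<epsilon> > 0\<close> by simp
    also have "\<dots> = N q" by (simp add: \<epsilon>_def)
    finally show False by simp
  qed
  \<comment> \<open>The bound \<open>M\<close> holds on the whole punctured plane and is attained at
    \<open>q1\<close>, now an interior maximum; the case s = 0 gives M = 0.\<close>
  have "\<forall>\<^sub>F q in nhds q1. q \<in> - {0}"
    using q1(1) by (intro eventually_nhds_in_open) auto
  then have "\<forall>\<^sub>F q in nhds q1. N q - 0 * ln (cmod q) \<le> N q1 - 0 * ln (cmod q1)"
    by eventually_elim (use global in \<open>auto simp: M_def\<close>)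
  moreover have "q1 \<noteq> 0" using q1(1) by auto
  ultimately have "M = 0"
    unfolding M_def N_def using toda_dist_zero_at_local_max[OF W V r _ sum_eq] by blast
  then have "N q = 0" using global[OF q] N_nonneg[of q] by simp
  then have zero: "W m q - V m q = 0" if "m \<in> {1..int r}" for m
    using that by (simp add: N_def toda_dist_def L2_set_eq_0_iff)
  obtain m where "m \<in> {1..int r}" "W n q - V n q = W m q - V m q"
    using periodic_exists_index[of "\<lambda>n. W n q - V n q" r n]
      periodic_todaD(1)[OF W] periodic_todaD(1)[OF V] r by auto
  then show ?thesis using zero by simp
qed

section \<open>The solution corresponding to a tuple of exponents\<close>

lemma has_real_derivative_along_line:
  fixes F :: "complex \<Rightarrow> real"
  assumes "(F has_derivative F') (at (q + of_real t * v))"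
  shows "((\<lambda>t. F (q + of_real t * v)) has_real_derivative F' v) (at t)"
proof -
  have "((\<lambda>t. q + complex_of_real t * v) has_derivative (\<lambda>h. of_real h * v)) (at t)"
    by (auto intro!: derivative_eq_intros)
  from has_derivative_compose[OF this assms]
  have "((\<lambda>t. F (q + of_real t * v)) has_derivative (\<lambda>h. F' (of_real h * v))) (at t)" .
  moreover have "F' (of_real h * v) = h * F' v" for h
    using linear_scale[OF has_derivative_linear[OF assms], of h v] by (simp add: scaleR_conv_of_real)
  ultimately show ?thesis
    by (simp add: has_field_derivative_def mult_commute_abs)
qed

text \<open>Four times the mixed Wirtinger derivative is the sum of the pure second derivatives plus
  \<i> times a difference of mixed ones. Taking the real part avoids the symmetry of second
  derivatives.\<close>

lemma smooth_on_has_laplacian: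
  fixes f :: "complex \<Rightarrow> real"
  assumes smooth: "smooth_on f (- {0})" and q: "q \<noteq> 0"
  shows "has_laplacian f q (4 * Re (d_qbar (d_q (\<lambda>p. complex_of_real (f p))) q))"
proof -
  define D where "D = (\<lambda>v x. frechet_derivative f (at x) v)"
  define D2 where "D2 = (\<lambda>v. frechet_derivative (D v) (at q))"
  have "Ck_on 2 f (- {0})" using smooth unfolding smooth_on_def by blast
  then have f: "f differentiable (at x)" and Df: "D v differentiable (at x)" if "x \<noteq> 0" for x v
    using that by (auto simp: numeral_2_eq_2 D_def)
  have f': "(f has_derivative (\<lambda>v. D v x)) (at x)" if "x \<noteq> 0" for x
    using frechet_derivative_works[of f "at x"] f[OF that] by (simp add: D_def)
  have D': "(D v has_derivative D2 v) (at q)" for v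
    using frechet_derivative_works[of "D v" "at q"] Df[OF q] by (simp add: D2_def)
  have dd: "has_second_dir_deriv f v q (D2 v v)" for v
    unfolding has_second_dir_deriv_def
  proof (intro exI[of _ "\<lambda>t. D v (q + of_real t * v)"] conjI)
    have "isCont (\<lambda>t::real. q + of_real t * v) 0" by (intro continuous_intros)
    then have "((\<lambda>t::real. q + of_real t * v) \<longlongrightarrow> q) (nhds 0)"
      using tendsto_at_iff_tendsto_nhds[of "\<lambda>t::real. q + of_real t * v" 0] by (simp add: isCont_def)
    then have "\<forall>\<^sub>F t::real in nhds 0. q + of_real t * v \<noteq> 0"
      using q by (rule tendsto_imp_eventually_ne)
    then show "\<forall>\<^sub>F t in nhds 0. ((\<lambda>t. f (q + of_real t * v))
        has_real_derivative D v (q + of_real t * v)) (at t)"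
      by eventually_elim (rule has_real_derivative_along_line[OF f'])
    show "((\<lambda>t. D v (q + of_real t * v)) has_real_derivative D2 v v) (at 0)"
      by (rule has_real_derivative_along_line) (use D' in simp)
  qed
  have dq: "d_q (\<lambda>p. complex_of_real (f p)) x = (of_real (D 1 x) - \<i> * of_real (D \<i> x)) / 2"
    if "x \<noteq> 0" for x
  proof -
    have "((\<lambda>p. complex_of_real (f p)) has_derivative (\<lambda>v. of_real (D v x))) (at x)"
      by (rule has_derivative_of_real[OF f'[OF that]])
    from frechet_derivative_at[OF this, symmetric] show ?thesis
      by (simp add: d_q_def)
  qed
  have "((\<lambda>x. (of_real (D 1 x) - \<i> * of_real (D \<i> x)) / 2) has_derivative
      (\<lambda>v. (of_real (D2 1 v) - \<i> * of_real (D2 \<i> v)) / 2)) (at q)"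
    by (intro bounded_linear.has_derivative[OF bounded_linear_divide] has_derivative_diff
      has_derivative_mult_right has_derivative_of_real D')
  then have "(d_q (\<lambda>p. complex_of_real (f p)) has_derivative
      (\<lambda>v. (of_real (D2 1 v) - \<i> * of_real (D2 \<i> v)) / 2)) (at q)"
    by (rule has_derivative_transform_within_open[of _ _ _ _ "- {0}"]) (use q dq in auto)
  from frechet_derivative_at[OF this, symmetric]
  have "4 * Re (d_qbar (d_q (\<lambda>p. complex_of_real (f p))) q) = D2 1 1 + D2 \<i> \<i>"
    by (simp add: d_qbar_def)
  then show ?thesis
    unfolding has_laplacian_def using dd by metis
qed

section \<open>Tuples as periodic families\<close>

lemma cyc_ext_of_nat:
  assumes "i \<in> {1..r}"
  shows "cyc_ext r x (int i) = x i"
proof -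
  have "(int i - 1) mod int r = int i - 1" using assms by (intro mod_pos_pos_trivial) auto
  then show ?thesis using assms by (simp add: cyc_ext_def nat_diff_distrib)
qed

lemma cyc_ext_eq:
  assumes "n \<in> {1..int r}"
  shows "cyc_ext r x n = x (nat n)"
  using assms cyc_ext_of_nat[of "nat n" r x] by (simp add: Suc_le_eq nat_le_iff)

lemma cyc_ext_periodic: "cyc_ext r x (n + int r) = cyc_ext r x n"
  by (simp add: cyc_ext_def add_diff_eq[symmetric] add.commute[of n])

lemma cyc_ext_in_image:
  assumes "r \<ge> 1"
  shows "\<exists>i\<in>{1..r}. cyc_ext r x n = x i"
proof -
  obtain m where m: "m \<in> {1..int r}" "cyc_ext r x n = cyc_ext r x m"
    using periodic_exists_index[of "cyc_ext r x" r n, OF cyc_ext_periodic assms] by auto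
  then show ?thesis
    by (intro bexI[of _ "nat m"]) (auto simp: cyc_ext_eq Suc_le_eq nat_le_iff)
qed

lemma sum_cyc_ext: "(\<Sum>n\<in>{1..int r}. g (cyc_ext r x n)) = (\<Sum>i=1..r. g (x i))"
  by (rule sum.reindex_bij_witness[of _ int nat]) (auto simp: cyc_ext_eq)

lemma toda_opposite_solution_periodic:
  assumes "toda_opposite_solution r w" "r \<ge> 1"
  shows "periodic_toda r (cyc_ext r w)"
  unfolding periodic_toda_def
proof (intro conjI allI impI)
  show "cyc_ext r w (n + int r) = cyc_ext r w n" for n by (rule cyc_ext_periodic)
  have smooth: "smooth_on (cyc_ext r w n) (- {0})" for n
    using cyc_ext_in_image[OF assms(2), of w n] assms(1) unfolding toda_opposite_solution_def by auto
  have "Ck_on 0 (cyc_ext r w n) (- {0})" for n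
    using smooth unfolding smooth_on_def by blast
  then show "continuous_on (- {0}) (cyc_ext r w n)" for n by simp
  fix n q
  assume q: "q \<noteq> (0::complex)"
  define W where "W = cyc_ext r w"
  define T where "T = (\<lambda>n. 2 * d_qbar (d_q (\<lambda>p. complex_of_real (W n p))) q
          - complex_of_real ((real r)\<^sup>2 * exp (2 * (W n q - W (n - 1) q)))
          + complex_of_real ((real r)\<^sup>2 * exp (2 * (W (n + 1) q - W n q))))"
  have per: "W (n + int r) = W n" for n unfolding W_def by (rule cyc_ext_periodic)
  \<comment> \<open>The system is stated for the indices 1, ..., r; periodicity of its left side
    carries it to all integers.\<close>
  have "T (n + int r) = T n" for n
    using per[of n] per[of "n - 1"] per[of "n + 1"] by (simp add: T_def algebra_simps)
  then obtain m where m: "m \<in> {1..int r}" "T n = T m"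
    using periodic_exists_index[of T r n] assms(2) by blast
  have T0: "\<forall>i\<in>{1..r}. T (int i) = 0"
    using assms(1) q unfolding toda_opposite_solution_def Let_def T_def W_def by blast
  have "nat m \<in> {1..r}" using m(1) by (auto simp: Suc_le_eq nat_le_iff)
  then have "T (int (nat m)) = 0" using T0 by blast
  then have "Re (T n) = 0" using m by simp
  moreover have "Re (2 * z - of_real A + of_real B) = 2 * Re z - A + B" for z A B by simp
  ultimately have "2 * Re (d_qbar (d_q (\<lambda>p. complex_of_real (W n p))) q)
      - (real r)\<^sup>2 * exp (2 * (W n q - W (n - 1) q)) + (real r)\<^sup>2 * exp (2 * (W (n + 1) q - W n q)) = 0"
    unfolding T_def by (simp only:)
  then have "4 * Re (d_qbar (d_q (\<lambda>p. complex_of_real (W n p))) q) =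
      2 * (real r)\<^sup>2 * (exp (2 * (W n q - W (n - 1) q)) - exp (2 * (W (n + 1) q - W n q)))"
    unfolding right_diff_distrib[of "2 * (real r)\<^sup>2"] by linarith
  then show "has_laplacian (cyc_ext r w n) q (2 * (real r)\<^sup>2 *
      (exp (2 * (cyc_ext r w n q - cyc_ext r w (n - 1) q))
       - exp (2 * (cyc_ext r w (n + 1) q - cyc_ext r w n q))))"
    using smooth_on_has_laplacian[OF smooth q, of n] unfolding W_def by (simp only:)
qed

section \<open>Asymptotics at the origin\<close>

lemma filterlim_ln_cmod_at_0: "filterlim (\<lambda>q. ln (cmod q)) at_bot (at 0)"
proof (rule filterlim_compose[OF ln_at_0])
  show "filterlim cmod (at_right 0) (at 0)"
    unfolding filterlim_at by (auto intro!: tendsto_norm_zero simp: eventually_at_filter)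
qed

text \<open>The logarithm of the O-bound taken with \<epsilon> / 2; the other half absorbs the
  logarithm of the implied constant once |q| is small.\<close>

lemma is_min_of_growth_upper:
  fixes w :: "complex \<Rightarrow> real"
  assumes "is_min_of a {c. \<forall>\<epsilon>>0. (\<lambda>q. cmod q ^ k * exp (w q)) \<in> O[at 0](\<lambda>q. cmod q powr (- c - \<epsilon>))}"
    and "\<epsilon> > 0"
  shows "\<forall>\<^sub>F q in at 0. w q + (a + real k) * ln (cmod q) \<le> \<epsilon> * \<bar>ln (cmod q)\<bar>"
proof -
  have "(\<lambda>q. cmod q ^ k * exp (w q)) \<in> O[at 0](\<lambda>q. cmod q powr (- a - \<epsilon> / 2))"
    using assms unfolding is_min_of_def by simp
  then obtain c where c: "c > 0"
    "\<forall>\<^sub>F q in at 0. norm (cmod q ^ k * exp (w q)) \<le> c * norm (cmod q powr (- a - \<epsilon> / 2))"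
    by (auto elim: landau_o.bigE)
  have "\<forall>\<^sub>F q in at 0. ln (cmod q) \<le> - (2 / \<epsilon>) * \<bar>ln c\<bar>"
    using filterlim_ln_cmod_at_0 unfolding filterlim_at_bot by blast
  moreover have "\<forall>\<^sub>F q in at 0. q \<noteq> (0::complex)" by (simp add: eventually_at_filter)
  ultimately show ?thesis
    using c(2)
  proof eventually_elim
    case (elim q)
    have "ln (cmod q ^ k * exp (w q)) \<le> ln (c * cmod q powr (- a - \<epsilon> / 2))"
      using elim c(1) by (subst ln_le_cancel_iff) auto
    then have "real k * ln (cmod q) + w q \<le> ln c + (- a - \<epsilon> / 2) * ln (cmod q)"
      using elim(2) c(1) by (simp add: ln_mult ln_realpow ln_powr)
    moreover have "\<bar>ln c\<bar> \<le> - (\<epsilon> / 2) * ln (cmod q)"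
      using elim(1) \<open>\<epsilon> > 0\<close> by (simp add: field_simps)
    moreover have "ln (cmod q) \<le> 0"
      using elim(1) \<open>\<epsilon> > 0\<close> order_trans[of _ "- (2 / \<epsilon>) * \<bar>ln c\<bar>" 0] by (simp add: mult_nonneg_nonneg)
    ultimately show ?case by (simp add: algebra_simps)
  qed
qed

text \<open>When the entries add up to 0, upper bounds for all of them are also lower bounds, since
  each entry is minus the sum of the others.\<close>

lemma sum_zero_upper_imp_smallo:
  fixes h :: "'i \<Rightarrow> 'a \<Rightarrow> real" and g :: "'a \<Rightarrow> real"
  assumes "finite S" "i \<in> S"
    and sum0: "\<forall>\<^sub>F x in F. (\<Sum>i\<in>S. h i x) = 0"
    and upper: "\<And>i \<epsilon>. i \<in> S \<Longrightarrow> \<epsilon> > 0 \<Longrightarrow> \<forall>\<^sub>F x in F. h i x \<le> \<epsilon> * \<bar>g x\<bar>"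
  shows "h i \<in> o[F](g)"
proof (rule landau_o.smallI)
  fix c :: real
  assume c: "c > 0"
  have card: "real (card S) \<ge> 1" using assms(1,2) by (auto simp: Suc_le_eq card_gt_0_iff)
  define \<epsilon> where "\<epsilon> = c / real (card S)"
  have "\<epsilon> > 0" using c card by (simp add: \<epsilon>_def)
  then have "\<forall>\<^sub>F x in F. \<forall>i\<in>S. h i x \<le> \<epsilon> * \<bar>g x\<bar>"
    using upper assms(1) by (intro eventually_ball_finite) auto
  with sum0 show "\<forall>\<^sub>F x in F. norm (h i x) \<le> c * norm (g x)"
  proof eventually_elim
    case (elim x)
    define K where "K = \<epsilon> * \<bar>g x\<bar>"
    have K: "K \<ge> 0" "real (card S) * K = c * \<bar>g x\<bar>"
      using \<open>\<epsilon> > 0\<close> card c by (auto simp: K_def \<epsilon>_def)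
    have le: "h j x \<le> K" if "j \<in> S" for j using elim(2) that by (simp add: K_def)
    have "- h i x = (\<Sum>j\<in>S - {i}. h j x)"
      using elim(1) sum.remove[OF assms(1,2), of "\<lambda>j. h j x"] by simp
    also have "\<dots> \<le> real (card (S - {i})) * K"
      by (rule sum_bounded_above) (use le in auto)
    also have "\<dots> \<le> real (card S) * K"
      using K(1) card_Diff1_le[of S i] by (intro mult_right_mono) auto
    finally have "- h i x \<le> c * \<bar>g x\<bar>" using K by simp
    moreover have "h i x \<le> c * \<bar>g x\<bar>"
      using le[OF assms(2)] mult_right_mono[OF card K(1)] K(2) by simp
    ultimately show ?case by simp
  qed
qed

text \<open>The order of w_n at 0: if |q|^(i-1) exp (w_i) grows like |q|^(-a_i), then w_i behaves
  like -(a_i + i - 1) ln |q|. The subtraction on naturals is safe, as \<open>cyc_ext\<close>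
  evaluates only at indices from 1 on.\<close>

definition toda_exponent :: "nat \<Rightarrow> (nat \<Rightarrow> real) \<Rightarrow> int \<Rightarrow> real" where
  "toda_exponent r a = cyc_ext r (\<lambda>i. a i + real (i - 1))"

lemma sum_toda_exponent:
  "(\<Sum>n\<in>{1..int r}. toda_exponent r a n) = (\<Sum>i=1..r. a i) + real r * (real r - 1) / 2"
proof -
  have "(\<Sum>i=1..r. real (i - 1)) = real r * (real r - 1) / 2"
    by (induction r) (auto simp: field_simps)
  then show ?thesis
    using sum_cyc_ext[of "\<lambda>x. x" r "\<lambda>i. a i + real (i - 1)"]
    by (simp add: toda_exponent_def sum.distrib)
qed

lemma toda_solution_sum:
  assumes "toda_solution_corresponding r a w" "q \<noteq> 0"
  shows "(\<Sum>n\<in>{1..int r}. cyc_ext r w n q) = - (\<Sum>n\<in>{1..int r}. toda_exponent r a n) * ln (cmod q)"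
proof -
  have "(\<Sum>n\<in>{1..int r}. cyc_ext r w n q) = (\<Sum>i=1..r. w i q)"
    by (rule sum_cyc_ext[of "\<lambda>f. f q"])
  also have "\<dots> = (- (real r * (real r - 1) / 2) - (\<Sum>i=1..r. a i)) * ln (cmod q)"
    using assms unfolding toda_solution_corresponding_def by blast
  finally show ?thesis unfolding sum_toda_exponent by simp
qed

lemma toda_solution_asymptotics:
  assumes sol: "toda_solution_corresponding r a w" and r: "r \<ge> 1"
  shows "(\<lambda>q. cyc_ext r w n q + toda_exponent r a n * ln (cmod q)) \<in> o[at 0](\<lambda>q. ln (cmod q))"
proof -
  define h where "h = (\<lambda>n q. cyc_ext r w n q + toda_exponent r a n * ln (cmod q))"
  have smallo: "h n \<in> o[at 0](\<lambda>q. ln (cmod q))" if "n \<in> {1..int r}" for n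
  proof (rule sum_zero_upper_imp_smallo[of "{1..int r}"])
    have "\<forall>\<^sub>F q in at 0. q \<noteq> (0::complex)" by (simp add: eventually_at_filter)
    \<comment> \<open>The normalization of the sum of the w_i is exactly minus the total exponent
      times ln |q|, so the remainders cancel identically.\<close>
    then show "\<forall>\<^sub>F q in at 0. (\<Sum>n\<in>{1..int r}. h n q) = 0"
      by eventually_elim
        (simp add: h_def sum.distrib toda_solution_sum[OF sol] flip: sum_distrib_right)
  next
    fix n and \<epsilon> :: real
    assume n: "n \<in> {1..int r}" and \<epsilon>: "\<epsilon> > 0"
    define i where "i = nat n"
    have i: "i \<in> {1..r}" "n = int i" using n by (auto simp: i_def)
    have "is_min_of (a i) {c. \<forall>\<epsilon>>0. (\<lambda>q. cmod q ^ (i - 1) * exp (w i q))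
        \<in> O[at 0](\<lambda>q. cmod q powr (- c - \<epsilon>))}"
      using sol i(1) unfolding toda_solution_corresponding_def by blast
    from is_min_of_growth_upper[OF this \<epsilon>]
    show "\<forall>\<^sub>F q in at 0. h n q \<le> \<epsilon> * \<bar>ln (cmod q)\<bar>"
      using i(1) by (simp add: h_def i(2) toda_exponent_def cyc_ext_of_nat)
  qed (use that in auto)
  have "h (n + int r) = h n" for n by (simp add: h_def toda_exponent_def cyc_ext_periodic)
  then obtain m where "m \<in> {1..int r}" "h n = h m"
    using periodic_exists_index[of h r n] r by blast
  then show ?thesis using smallo[of m] by (simp add: h_def)
qed

lemma toda_exponent_r0_periodic:
  assumes "r \<ge> 1"
  shows "toda_exponent r a (n + int (toda_r0 r a)) = toda_exponent r a n"
proof -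
  define J where "J = {j \<in> {1..r}. \<forall>i. toda_b r a (i + int j) = toda_b r a i}"
  have "r \<in> J" using assms by (simp add: J_def toda_b_def cyc_ext_periodic)
  moreover have "finite J" by (simp add: J_def)
  ultimately have "toda_r0 r a \<in> J" unfolding toda_r0_def J_def[symmetric] by (intro Min_in) auto
  then have "toda_b r a (n + int (toda_r0 r a)) = toda_b r a n" by (simp add: J_def)
  \<comment> \<open>\<open>toda_b\<close> is an affine function of the exponent, so the two have the
    same periods.\<close>
  moreover have "toda_b r a i = real r * (toda_exponent r a i + 1)" for i
    by (simp add: toda_b_def toda_exponent_def cyc_ext_def algebra_simps)
  ultimately show ?thesis using assms by simp
qed

text \<open>The representative of 1 - k_0 - n in 1, ..., r is obtained by adding r or 2r, which are
  the two cases of the hypothesis. The extra -r in the second case cancels the extra r in n + j, so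
  both give the same constant.\<close>

lemma toda_exponent_reflect:
  fixes k\<^sub>0 l :: int
  assumes r: "r \<ge> 1" and k: "0 \<le> k\<^sub>0" "k\<^sub>0 \<le> int r - 1"
    and a1: "\<And>i j. i \<in> {1..r} \<Longrightarrow> j \<in> {1..r} \<Longrightarrow> int i + int j = int r + 1 - k\<^sub>0 \<Longrightarrow>
           a i + a j = - real_of_int l"
    and a2: "\<And>i j. i \<in> {1..r} \<Longrightarrow> j \<in> {1..r} \<Longrightarrow> int i + int j = 2 * int r + 1 - k\<^sub>0 \<Longrightarrow>
           a i + a j = - real_of_int l - real r"
    and n: "n \<in> {1..int r}"
  shows "toda_exponent r a n + toda_exponent r a (1 - k\<^sub>0 - n)
           = - (real_of_int l - real r + 1 + real_of_int k\<^sub>0)"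
proof -
  have \<alpha>: "toda_exponent r a j = a (nat j) + real_of_int j - 1" if "j \<in> {1..int r}" for j
    using that by (auto simp: toda_exponent_def cyc_ext_eq of_nat_diff)
  have per: "toda_exponent r a (j + int r) = toda_exponent r a j" for j
    by (simp add: toda_exponent_def cyc_ext_periodic)
  show ?thesis
  proof (cases "n \<le> int r - k\<^sub>0")
    case True
    define j where "j = 1 - k\<^sub>0 - n + int r"
    have j: "j \<in> {1..int r}" using True n k by (auto simp: j_def)
    have "a (nat n) + a (nat j) = - real_of_int l"
      using n j by (intro a1) (auto simp: j_def)
    moreover have "toda_exponent r a (1 - k\<^sub>0 - n) = toda_exponent r a j"
      unfolding j_def by (rule per[symmetric])
    ultimately show ?thesis using \<alpha>[OF n] \<alpha>[OF j] by (simp add: j_def)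
  next
    case False
    define j where "j = 1 - k\<^sub>0 - n + int r + int r"
    have j: "j \<in> {1..int r}" using False n k by (auto simp: j_def)
    have "a (nat n) + a (nat j) = - real_of_int l - real r"
      using n j by (intro a2) (auto simp: j_def)
    moreover have "toda_exponent r a (1 - k\<^sub>0 - n) = toda_exponent r a j"
      unfolding j_def by (simp only: per)
    ultimately show ?thesis using \<alpha>[OF n] \<alpha>[OF j] by (simp add: j_def)
  qed
qed

section \<open>Shift and reflection symmetries of the solution\<close>

theorem theorem3p35:
  fixes r :: nat and a :: "nat \<Rightarrow> real" and w :: "nat \<Rightarrow> complex \<Rightarrow> real" and k\<^sub>0 l :: int
  assumes "r \<ge> 1"
    and "\<And>i. 1 \<le> i \<Longrightarrow> i < r \<Longrightarrow> a i \<ge> a (i + 1)"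
    and "a r \<ge> a 1 - real r"
    and "toda_solution_corresponding r a w"
    and "0 \<le> k\<^sub>0" and "k\<^sub>0 \<le> int r - 1"
    and "\<And>i j. i \<in> {1..r} \<Longrightarrow> j \<in> {1..r} \<Longrightarrow> int i + int j = int r + 1 - k\<^sub>0 \<Longrightarrow>
           a i + a j = - real_of_int l"
    and "\<And>i j. i \<in> {1..r} \<Longrightarrow> j \<in> {1..r} \<Longrightarrow> int i + int j = 2 * int r + 1 - k\<^sub>0 \<Longrightarrow>
           a i + a j = - real_of_int l - real r"
  shows "\<forall>i\<in>{1..r}. \<forall>j\<in>{1..r}. [int i + int j + k\<^sub>0 - 1 = 0] (mod int (toda_r0 r a)) \<longrightarrow>
           (\<forall>q. q \<noteq> 0 \<longrightarrow>
             w i q + w j q = (real_of_int l - real r + 1 + real_of_int k\<^sub>0) * ln (cmod q))"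
proof (intro ballI impI allI)
  fix i j q
  assume i: "i \<in> {1..r}" and j: "j \<in> {1..r}" and q: "q \<noteq> (0::complex)"
    and cong: "[int i + int j + k\<^sub>0 - 1 = 0] (mod int (toda_r0 r a))"
  define W where "W = cyc_ext r w"
  define \<alpha> where "\<alpha> = toda_exponent r a"
  define c where "c = real_of_int l - real r + 1 + real_of_int k\<^sub>0"
  define s where "s = int (toda_r0 r a)"
  have W: "periodic_toda r W"
    using toda_opposite_solution_periodic assms(1,4)
    unfolding W_def toda_solution_corresponding_def by blast
  have \<alpha>_per: "\<alpha> (n + int r) = \<alpha> n" for n
    by (simp add: \<alpha>_def toda_exponent_def cyc_ext_periodic)
  have W_per: "W (n + int r) q = W n q" for n q
    using periodic_todaD(1)[OF W] by simp
  note asym = toda_solution_asymptotics[OF assms(4,1), folded W_def \<alpha>_def]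
  note W_sum = toda_solution_sum[OF assms(4), folded W_def \<alpha>_def]
  have \<alpha>_reflect: "\<alpha> n + \<alpha> (1 - k\<^sub>0 - n) = - c" if "n \<in> {1..int r}" for n
    unfolding \<alpha>_def c_def
    by (rule toda_exponent_reflect[OF assms(1,5,6)]) (use assms(7,8) that in auto)

  have shift: "W n q = W (n + s) q" for n
  proof (rule periodic_toda_unique[OF W periodic_toda_shift[OF W] assms(1)])
    fix n
    have "\<alpha> (n + s) = \<alpha> n"
      unfolding \<alpha>_def s_def by (rule toda_exponent_r0_periodic[OF assms(1)])
    then show "(\<lambda>q. W n q - W (n + s) q) \<in> o[at 0](\<lambda>q. ln (cmod q))"
      using sum_in_smallo(2)[OF asym[of n] asym[of "n + s"]] by simp
  next
    fix q
    show "(\<Sum>n\<in>{1..int r}. W n q) = (\<Sum>n\<in>{1..int r}. W (n + s) q)"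
      using periodic_sum_shift[of "\<lambda>n. W n q", OF W_per] by simp
  qed (rule q)

  have reflect: "W n q = c * ln (cmod q) - W (1 - k\<^sub>0 - n) q" for n
  proof (rule periodic_toda_unique[OF W periodic_toda_reflect[OF W] assms(1)])
    fix n
    assume n: "n \<in> {1..int r}"
    have eq: "W n q - (c * ln (cmod q) - W (1 - k\<^sub>0 - n) q) = (W n q + \<alpha> n * ln (cmod q))
        + (W (1 - k\<^sub>0 - n) q + \<alpha> (1 - k\<^sub>0 - n) * ln (cmod q))" for q
    proof -
      \<comment> \<open>This \<open>c\<close> is the choice for which the leading terms of the
        solution and its reflection agree at 0.\<close>
      have c: "c = - \<alpha> n - \<alpha> (1 - k\<^sub>0 - n)" using \<alpha>_reflect[OF n] by simp
      show ?thesis unfolding c by (simp add: left_diff_distrib distrib_right)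
    qed
    show "(\<lambda>q. W n q - (c * ln (cmod q) - W (1 - k\<^sub>0 - n) q)) \<in> o[at 0](\<lambda>q. ln (cmod q))"
      unfolding eq by (rule sum_in_smallo(1)[OF asym asym])
  next
    fix q :: complex
    assume "q \<noteq> 0"
    \<comment> \<open>Summing the reflection identity for the exponents over a period gives r c =
      -2A, so reflecting preserves the sum -A ln |q|.\<close>
    define A where "A = (\<Sum>n\<in>{1..int r}. \<alpha> n)"
    have "A + A = (\<Sum>n\<in>{1..int r}. \<alpha> n + \<alpha> (1 - k\<^sub>0 - n))"
      using periodic_sum_reflect[of \<alpha> r "1 - k\<^sub>0", OF \<alpha>_per] by (simp add: A_def sum.distrib)
    also have "\<dots> = - (real r * c)" using \<alpha>_reflect by simp
    finally have "real r * c = - A - A" by simp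
    moreover have "(\<Sum>n\<in>{1..int r}. c * ln (cmod q) - W (1 - k\<^sub>0 - n) q)
        = (real r * c) * ln (cmod q) - (\<Sum>n\<in>{1..int r}. W n q)"
      using periodic_sum_reflect[of "\<lambda>n. W n q" r "1 - k\<^sub>0", OF W_per] by (simp add: sum_subtractf)
    ultimately show "(\<Sum>n\<in>{1..int r}. W n q) = (\<Sum>n\<in>{1..int r}. c * ln (cmod q) - W (1 - k\<^sub>0 - n) q)"
      using W_sum[OF \<open>q \<noteq> 0\<close>] by (simp add: A_def[symmetric] algebra_simps)
  qed (rule q)

  obtain t where "int i + int j + k\<^sub>0 - 1 = s * t"
    using cong unfolding s_def cong_0_iff by (elim dvdE)
  \<comment> \<open>The congruence says that \<open>j\<close> is the reflection of \<open>i\<close>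
    up to a multiple of the period \<open>s\<close>.\<close>
  then have "int j = (1 - k\<^sub>0 - int i) + s * t" by simp
  then have "W (int j) q = W (1 - k\<^sub>0 - int i) q"
    using periodic_mult[of "\<lambda>n. W n q" s "1 - k\<^sub>0 - int i" t] shift by simp
  then have "W (int i) q + W (int j) q = c * ln (cmod q)"
    using reflect[of "int i"] by simp
  then show "w i q + w j q = (real_of_int l - real r + 1 + real_of_int k\<^sub>0) * ln (cmod q)"
    using i j by (simp add: W_def c_def cyc_ext_of_nat)
qed

end
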